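(* Let $1<p<\infty$, let $\Omega\subset\mathbb{R}^d$ be open and let $v\in W^{1,p}(\mathbb{R}^d)$. Assume that $v\in W^{1,p}_0(\Omega)$ (extended by zero) or that $|\partial\Omega|=0$. Let $u_\varepsilon\in W^p_{\nu_\varepsilon}(\Omega|\mathbb{R}^d)$, $\varepsilon>0$, satisfy $\sup_{\varepsilon>0}\mathcal{E}^\varepsilon_{cr}(u_\varepsilon,u_\varepsilon)<\infty$. Then $$\lim_{\varepsilon\to0}\mathcal{E}^\varepsilon_{cr}(u_\varepsilon,v)=\lim_{\varepsilon\to0}\mathcal{E}^\varepsilon_{cr}(v,u_\varepsilon)=0.$$
   Context: Kernels: $(\nu_\varepsilon)_{\varepsilon>0}$ is a family of radial measurable functions $\nu_\varepsilon:\mathbb{R}^d\setminus\{0\}\to[0,\infty)$, $d\ge1$, with $\int_{\mathbb{R}^d}(1\wedge|h|^p)\nu_\varepsilon(h)\,dh=1$ and $\lim_{\varepsilon\to0}\int_{|h|>\delta}\nu_\varepsilon(h)\,dh=0$ for every $\delta>0$. With $\Omega^c=\mathbb{R}^d\setminus\Omega$, the forms $\mathcal{E}^\varepsilon(u,v)$ and $\mathcal{E}^\varepsilon_{cr}(u,v)$ are the integrals of $|u(x)-u(y)|^{p-2}(u(x)-u(y))(v(x)-v(y))\nu_\varepsilon(x-y)$ with respect to $dy\,dx$ over $(\Omega^c\times\Omega^c)^c$ and over $\{(x,y):x\in\Omega,\ y\in\Omega^c\}$, respectively. $W^p_{\nu_\varepsilon}(\Omega|\mathbb{R}^d)$ is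 the space of measurable $u:\mathbb{R}^d\to\mathbb{R}$ with $u|_\Omega\in L^p(\Omega)$ and $\mathcal{E}^\varepsilon(u,u)<\infty$. *)

theory Defs
  imports "HOL-Analysis.Analysis"
begin

primrec Ck :: "nat \<Rightarrow> ('a::euclidean_space \<Rightarrow> real) \<Rightarrow> bool" where
  "Ck 0 f \<longleftrightarrow> continuous_on UNIV f"
| "Ck (Suc k) f \<longleftrightarrow>
     (\<forall>x. f differentiable (at x)) \<and> (\<forall>b\<in>Basis. Ck k (\<lambda>x. frechet_derivative f (at x) b))"

definition test_functions :: "'a::euclidean_space set \<Rightarrow> ('a \<Rightarrow> real) set" where
  "test_functions U =
     {\<phi>. (\<forall>k. Ck k \<phi>) \<and> compact (closure {x. \<phi> x \<noteq> 0}) \<and> closure {x. \<phi> x \<noteq> 0} \<subseteq> U}"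

definition grad :: "('a::euclidean_space \<Rightarrow> real) \<Rightarrow> 'a \<Rightarrow> 'a" where
  "grad \<phi> x = (\<Sum>b\<in>Basis. frechet_derivative \<phi> (at x) b *\<^sub>R b)"

definition Lp_on :: "real \<Rightarrow> 'a::euclidean_space set \<Rightarrow> ('a \<Rightarrow> 'b::euclidean_space) set" where
  "Lp_on p U = {f. f \<in> borel_measurable (lebesgue_on U) \<and>
                   integrable (lebesgue_on U) (\<lambda>x. norm (f x) powr p)}"

definition weak_gradient_on ::
  "'a::euclidean_space set \<Rightarrow> ('a \<Rightarrow> real) \<Rightarrow> ('a \<Rightarrow> 'a) \<Rightarrow> bool" where
  "weak_gradient_on U u g \<longleftrightarrow>
     (\<forall>\<phi>\<in>test_functions U. \<forall>b\<in>Basis.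
        (LINT x|lebesgue_on U. u x * (grad \<phi> x \<bullet> b)) =
        - (LINT x|lebesgue_on U. (g x \<bullet> b) * \<phi> x))"

definition sobolev_W1p :: "real \<Rightarrow> 'a::euclidean_space set \<Rightarrow> ('a \<Rightarrow> real) set" where
  "sobolev_W1p p U = {u. u \<in> Lp_on p U \<and> (\<exists>g\<in>Lp_on p U. weak_gradient_on U u g)}"

text \<open>The closure of the test functions in \<open>W\<^sup>1\<^sup>,\<^sup>p(U)\<close>. The weak gradient
  \<open>g\<close> of \<open>u\<close> is unique up to null sets, so the second limit does not depend on its choice.
  Only the values of \<open>u\<close> on \<open>U\<close> matter.\<close>

definition sobolev_W01p :: "real \<Rightarrow> 'a::euclidean_space set \<Rightarrow> ('a \<Rightarrow> real) set" where
  "sobolev_W01p p U =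
     {u. u \<in> Lp_on p U \<and>
         (\<exists>g\<in>Lp_on p U. weak_gradient_on U u g \<and>
            (\<exists>\<phi>::nat \<Rightarrow> 'a \<Rightarrow> real. (\<forall>n. \<phi> n \<in> test_functions U) \<and>
               (\<lambda>n. LINT x|lebesgue_on U. \<bar>u x - \<phi> n x\<bar> powr p) \<longlonglongrightarrow> 0 \<and>
               (\<lambda>n. LINT x|lebesgue_on U. norm (g x - grad (\<phi> n) x) powr p) \<longlonglongrightarrow> 0))}"

text \<open>A kernel is a function on the whole space whose value at the origin is unconstrained; that
  value plays no role below, as only integrals of the kernel occur. The normalization forces
  integrability, since the Bochner integral of a non-integrable function is \<open>0\<close>; integrability
  of the kernel away from the origin follows.\<close>

definition kernel_family :: "real \<Rightarrow> (real \<Rightarrow> 'a::euclidean_space \<Rightarrow> real) \<Rightarrow> bool" where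
  "kernel_family p \<nu> \<longleftrightarrow>
     (\<forall>\<epsilon>>0. \<nu> \<epsilon> \<in> borel_measurable (lebesgue_on (- {0})) \<and>
            (\<forall>h. h \<noteq> 0 \<longrightarrow> 0 \<le> \<nu> \<epsilon> h) \<and>
            (\<forall>h k. h \<noteq> 0 \<longrightarrow> k \<noteq> 0 \<longrightarrow> norm h = norm k \<longrightarrow> \<nu> \<epsilon> h = \<nu> \<epsilon> k) \<and>
            (LINT h|lebesgue. min 1 (norm h powr p) * \<nu> \<epsilon> h) = 1) \<and>
     (\<forall>\<delta>>0. ((\<lambda>\<epsilon>. LINT h:{h. \<delta> < norm h}|lebesgue. \<nu> \<epsilon> h) \<longlongrightarrow> 0) (at_right 0))"

text \<open>Since \<open>0 powr a = 0\<close> for every \<open>a\<close>, the integrand vanishes where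
  \<open>u x = u y\<close>, also for \<open>p < 2\<close>.\<close>

definition form_integrand ::
  "real \<Rightarrow> ('a::euclidean_space \<Rightarrow> real) \<Rightarrow> ('a \<Rightarrow> real) \<Rightarrow> ('a \<Rightarrow> real) \<Rightarrow> 'a \<times> 'a \<Rightarrow> real" where
  "form_integrand p \<nu> u v =
     (\<lambda>(x, y). \<bar>u x - u y\<bar> powr (p - 2) * (u x - u y) * (v x - v y) * \<nu> (x - y))"

definition form_cr ::
  "real \<Rightarrow> 'a::euclidean_space set \<Rightarrow> ('a \<Rightarrow> real) \<Rightarrow> ('a \<Rightarrow> real) \<Rightarrow> ('a \<Rightarrow> real) \<Rightarrow> real" where
  "form_cr p \<Omega> \<nu> u v = (LINT z:\<Omega> \<times> (- \<Omega>)|lebesgue. form_integrand p \<nu> u v z)"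

text \<open>The condition \<open>\<E>(u,u) < \<infinity>\<close> is integrability, the integrand being
  measurable and, off the diagonal, nonnegative.\<close>

definition nonlocal_W :: "real \<Rightarrow> 'a::euclidean_space set \<Rightarrow> ('a \<Rightarrow> real) \<Rightarrow> ('a \<Rightarrow> real) set" where
  "nonlocal_W p \<Omega> \<nu> =
     {u. u \<in> borel_measurable lebesgue \<and> u \<in> Lp_on p \<Omega> \<and>
         set_integrable lebesgue (- ((- \<Omega>) \<times> (- \<Omega>))) (form_integrand p \<nu> u u)}"

end

theory Submission
  imports Defs
begin

text \<open>By an elementary form of Young's inequality, for every \<open>e > 0\<close>, both mixed forms are bounded in absolute value
by \<open>e * \<E>(u, u) + c * \<E>(v, v)\<close> with \<open>c\<close> depending only on \<open>e\<close> and \<open>p\<close>. As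
\<open>\<E>(u\<^sub>\<epsilon>, u\<^sub>\<epsilon>)\<close> is bounded, the theorem reduces to one statement about \<open>v\<close> alone: its energy
across the boundary, \<open>\<E>\<^sub>c\<^sub>r(v, v)\<close>, is finite and tends to \<open>0\<close>.

The substitution \<open>y = x - h\<close> writes this energy as an integral, against the kernel in \<open>h\<close>, of the
integral of \<open>\<bar>v(x) - v(x - h)\<bar> powr p\<close> over all \<open>x \<in> \<Omega>\<close> with \<open>x - h \<notin> \<Omega>\<close>.
Jumps with \<open>norm h > \<delta>\<close> contribute at most a multiple of the integral of \<open>\<bar>v\<bar> powr p\<close> times the mass
of the kernel outside the ball of radius \<open>\<delta>\<close>, which vanishes in the limit. For a short jump the
segment from \<open>x\<close> to \<open>x - h\<close> meets the boundary, so it stays in a strip around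
\<open>\<partial>\<Omega>\<close>; the inner integral is then at most \<open>norm h powr p\<close> times the integral of a
gradient term \<open>G\<close> over that strip (\<open>translation_bound\<close>), and the normalization of the kernel turns this
into the integral of \<open>G\<close> over the strip (\<open>crossing_energy_le\<close>). As \<open>\<delta>\<close> tends to \<open>0\<close> the strips
shrink to \<open>\<partial>\<Omega>\<close>, on which \<open>G\<close> vanishes almost everywhere.

The two alternatives for \<open>v\<close> serve only to produce such a \<open>G\<close>, a multiple of \<open>norm g powr p\<close>.
If \<open>\<partial>\<Omega>\<close> is a null set, \<open>g\<close> is the weak gradient on the whole space: integrating the
definition of the weak gradient along segments shows that \<open>v(x + h) - v(x)\<close> is almost everywhere the line
integral of \<open>g\<close> (\<open>weak_gradient_line_integral\<close>), which rests on the fundamental lemma of the calculus of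
variations and hence on smooth bump functions. If \<open>v\<close> is a limit of test functions supported in
\<open>\<Omega>\<close>, the bound is inherited from them (\<open>translation_bound_limit\<close>), and \<open>g\<close> is the weak
gradient on \<open>\<Omega>\<close> extended by zero, which vanishes on \<open>\<partial>\<Omega>\<close> because \<open>\<Omega>\<close>
is open.\<close>

text \<open>The powers of \<open>1 / t\<close> make this family of flat functions closed under differentiation up to
linear combinations, so that smoothness of all its members follows by a single induction.\<close>

section \<open>Smooth bump functions and the fundamental lemma of the calculus of variations\<close>

definition flat :: "nat \<Rightarrow> real \<Rightarrow> real" where
  "flat m t = (if t \<le> 0 then 0 else exp (- 1 / t) / t ^ m)"

lemma flat_nonneg: "0 \<le> flat m t"
  by (simp add: flat_def)

text \<open>With \<open>s = 1 / t\<close> this is the decay of \<open>s ^ m / exp s\<close>.\<close>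

lemma flat_tendsto_0: "(flat m \<longlongrightarrow> 0) (at 0)"
proof -
  have "((\<lambda>t::real. (inverse t) ^ m / exp (inverse t)) \<longlongrightarrow> 0) (at_right 0)"
    by (rule filterlim_compose[OF tendsto_power_div_exp_0 filterlim_inverse_at_top_right])
  moreover have "\<forall>\<^sub>F t in at_right 0. (inverse t) ^ m / exp (inverse t) = flat m t"
    unfolding eventually_at_right_field
    by (intro exI[of _ 1]) (auto simp: flat_def exp_minus field_simps)
  ultimately have r: "(flat m \<longlongrightarrow> 0) (at_right 0)"
    by (rule Lim_transform_eventually)
  have "\<forall>\<^sub>F t in at_left 0. 0 = flat m t"
    unfolding eventually_at_left_field by (intro exI[of _ "-1"]) (auto simp: flat_def)
  then have l: "(flat m \<longlongrightarrow> 0) (at_left 0)"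
    by (rule Lim_transform_eventually[OF tendsto_const])
  show ?thesis
    using l r by (rule filterlim_split_at_real)
qed

text \<open>At the origin the difference quotient of \<open>flat m\<close> is \<open>flat (m + 1)\<close>, so that the
formula holds there by \<open>flat_tendsto_0\<close>.\<close>

lemma DERIV_flat: "(flat m has_real_derivative flat (m + 2) t - real m * flat (m + 1) t) (at t)"
proof -
  consider "t < 0" | "t = 0" | "t > 0" by linarith
  then show ?thesis
  proof cases
    case 1
    have "((\<lambda>_. 0) has_real_derivative 0) (at t)" by simp
    then have "(flat m has_real_derivative 0) (at t)"
      by (rule has_field_derivative_transform_within_open[of _ _ _ "{..<0}"]) (use 1 in \<open>auto simp: flat_def\<close>)
    then show ?thesis using 1 by (simp add: flat_def)
  next
    case 2
    have "((\<lambda>s. (flat m s - flat m 0) / (s - 0)) \<longlongrightarrow> 0) (at 0)"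
    proof (rule Lim_transform_eventually[OF flat_tendsto_0[of "Suc m"]])
      show "\<forall>\<^sub>F s in at 0. flat (Suc m) s = (flat m s - flat m 0) / (s - 0)"
        by (intro always_eventually) (auto simp: flat_def)
    qed
    then have "(flat m has_real_derivative 0) (at 0)"
      by (simp add: has_field_derivative_iff)
    then show ?thesis using 2 by (simp add: flat_def)
  next
    case 3
    have "((\<lambda>t. inverse t ^ m) has_real_derivative - (real m * inverse t ^ (m + 1))) (at t)"
      using DERIV_power[OF DERIV_inverse, of t m UNIV] 3 by (cases m) (auto simp: algebra_simps)
    moreover have "((\<lambda>t. exp (- 1 / t)) has_real_derivative exp (- 1 / t) * inverse t ^ 2) (at t)"
      using 3 by (auto intro!: derivative_eq_intros simp: power2_eq_square field_simps)
    ultimately have "((\<lambda>t. exp (- 1 / t) * inverse t ^ m) has_real_derivative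
        (exp (- 1 / t) * inverse t ^ (m + 2) - real m * (exp (- 1 / t) * inverse t ^ (m + 1)))) (at t)"
      by (auto dest: DERIV_mult simp: algebra_simps power_add power2_eq_square)
    then have "((\<lambda>t. exp (- 1 / t) * inverse t ^ m) has_real_derivative
        (flat (m + 2) t - real m * flat (m + 1) t)) (at t)"
      using 3 by (simp add: flat_def field_simps)
    then show ?thesis
      by (rule has_field_derivative_transform_within_open[of _ _ _ "{0<..}"])
         (use 3 in \<open>auto simp: flat_def field_simps\<close>)
  qed
qed

lemma Ck_SucI:
  assumes "\<And>x. (f has_derivative D x) (at x)" "\<And>b. b \<in> Basis \<Longrightarrow> Ck k (\<lambda>x. D x b)"
  shows "Ck (Suc k) f"
proof -
  have "frechet_derivative f (at x) = D x" for x
    using frechet_derivative_at[OF assms(1)[of x]] by simp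
  then show ?thesis
    using assms by (auto simp: differentiable_def)
qed

lemma Ck_has_derivative:
  "Ck (Suc k) f \<Longrightarrow> (f has_derivative frechet_derivative f (at x)) (at x)"
  by (simp add: frechet_derivative_works)

lemma Ck_SucD: "Ck (Suc k) f \<Longrightarrow> Ck k f"
proof (induction k arbitrary: f)
  case 0
  then show ?case
    by (auto intro!: continuous_at_imp_continuous_on differentiable_imp_continuous_within)
next
  case (Suc k)
  then show ?case by (simp only: Ck.simps) blast
qed

lemma Ck_const: "Ck k (\<lambda>x. c)"
proof (induction k arbitrary: c)
  case (Suc k)
  then show ?case by (intro Ck_SucI[where D="\<lambda>x h. 0"]) auto
qed simp

lemma Ck_add: "Ck k f \<Longrightarrow> Ck k g \<Longrightarrow> Ck k (\<lambda>x. f x + g x)"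
proof (induction k arbitrary: f g)
  case (Suc k)
  show ?case
    by (rule Ck_SucI[where D="\<lambda>x h. frechet_derivative f (at x) h + frechet_derivative g (at x) h"])
       (use Suc in \<open>auto intro!: has_derivative_add simp: frechet_derivative_works[symmetric]\<close>)
qed (simp add: continuous_on_add)

text \<open>The product rule expresses the partial derivatives through products of \<open>C\<^sup>k\<close> functions.\<close>

lemma Ck_mult: "Ck k f \<Longrightarrow> Ck k g \<Longrightarrow> Ck k (\<lambda>x. f x * g x)"
proof (induction k arbitrary: f g)
  case (Suc k)
  show ?case
  proof (rule Ck_SucI[where D="\<lambda>x h. f x * frechet_derivative g (at x) h + frechet_derivative f (at x) h * g x"])
    show "((\<lambda>x. f x * g x) has_derivative
        (\<lambda>h. f x * frechet_derivative g (at x) h + frechet_derivative f (at x) h * g x)) (at x)" for x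
      by (intro has_derivative_mult Ck_has_derivative[OF Suc.prems(1)] Ck_has_derivative[OF Suc.prems(2)])
    show "Ck k (\<lambda>x. f x * frechet_derivative g (at x) b + frechet_derivative f (at x) b * g x)"
      if "b \<in> Basis" for b
      using that Suc.prems by (intro Ck_add Suc.IH) (auto dest: Ck_SucD[of k f] Ck_SucD[of k g] simp del: Ck.simps, auto)
  qed
qed (simp add: continuous_on_mult)

lemma Ck_prod: "(\<And>i. i \<in> I \<Longrightarrow> Ck k (f i)) \<Longrightarrow> Ck k (\<lambda>x. \<Prod>i\<in>I. f i x)"
  by (induction I rule: infinite_finite_induct) (auto intro: Ck_const Ck_mult)

lemma Ck_translate: "Ck k f \<Longrightarrow> Ck k (\<lambda>x. f (x + a))"
proof (induction k arbitrary: f)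
  case 0
  then show ?case by (auto intro!: continuous_intros continuous_on_compose2[of UNIV f])
next
  case (Suc k)
  show ?case
  proof (rule Ck_SucI[where D="\<lambda>x. frechet_derivative f (at (x + a))"])
    show "((\<lambda>x. f (x + a)) has_derivative frechet_derivative f (at (x + a))) (at x)" for x
      by (rule has_derivative_compose[where g=f and f="\<lambda>x. x + a" and f'="\<lambda>h. h"])
         (use Ck_has_derivative[OF Suc.prems(1), of "x + a"] in \<open>auto intro!: derivative_eq_intros\<close>)
  qed (use Suc in auto)
qed

lemma Ck_flat: "Ck k (\<lambda>x. flat m (r * (x \<bullet> e) + s))"
proof (induction k arbitrary: m)
  case 0
  have "continuous_on UNIV (flat m)"
    by (auto intro!: continuous_at_imp_continuous_on DERIV_isCont[OF DERIV_flat])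
  then show ?case
    by (auto intro!: continuous_intros continuous_on_compose2[of UNIV "flat m"])
next
  case (Suc k)
  show ?case
  proof (rule Ck_SucI[where D="\<lambda>x h. (flat (m + 2) (r * (x \<bullet> e) + s)
      + (- real m) * flat (m + 1) (r * (x \<bullet> e) + s)) * (r * (h \<bullet> e))"])
    show "((\<lambda>x. flat m (r * (x \<bullet> e) + s)) has_derivative
       (\<lambda>h. (flat (m + 2) (r * (x \<bullet> e) + s) + (- real m) * flat (m + 1) (r * (x \<bullet> e) + s)) * (r * (h \<bullet> e)))) (at x)" for x
      by (rule has_derivative_compose[OF _ DERIV_flat[unfolded has_field_derivative_def], THEN has_derivative_eq_rhs])
         (auto intro!: derivative_eq_intros simp: algebra_simps)
    show "Ck k (\<lambda>x. (flat (m + 2) (r * (x \<bullet> e) + s) + (- real m) * flat (m + 1) (r * (x \<bullet> e) + s)) * (r * (b \<bullet> e)))" for b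
      by (intro Ck_mult Ck_add Ck_const Suc.IH)
  qed
qed

text \<open>Each factor \<open>flat 0 (n * t)\<close> with \<open>t > 0\<close> equals \<open>exp (- 1 / (n * t))\<close> and increases to \<open>1\<close>.
These bumps therefore approximate the indicator of the open box while they are supported in its closure. The arguments are written in the affine form of \<open>Ck_flat\<close>.\<close>

definition bump :: "'a::euclidean_space \<Rightarrow> 'a \<Rightarrow> nat \<Rightarrow> 'a \<Rightarrow> real" where
  "bump a c n x =
     (\<Prod>b\<in>Basis. flat 0 (real (Suc n) * (x \<bullet> b) + - real (Suc n) * (a \<bullet> b)) *
                  flat 0 (- real (Suc n) * (x \<bullet> b) + real (Suc n) * (c \<bullet> b)))"

lemma bump_eq_0: "x \<notin> box a c \<Longrightarrow> bump a c n x = 0"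
proof -
  assume "x \<notin> box a c"
  then obtain b where b: "b \<in> Basis" "x \<bullet> b \<le> a \<bullet> b \<or> c \<bullet> b \<le> x \<bullet> b"
    by (auto simp: box_def not_less)
  then have "flat 0 (real (Suc n) * (x \<bullet> b) + - real (Suc n) * (a \<bullet> b)) *
                  flat 0 (- real (Suc n) * (x \<bullet> b) + real (Suc n) * (c \<bullet> b)) = 0"
    using mult_left_mono[of "x \<bullet> b" "a \<bullet> b" "real (Suc n)"]
      mult_left_mono[of "c \<bullet> b" "x \<bullet> b" "real (Suc n)"]
    by (auto simp: flat_def simp del: of_nat_Suc)
  then show ?thesis
    unfolding bump_def using b(1) by (intro prod_zero) auto
qed

lemma flat_0_le_1: "flat 0 t \<le> 1"
  by (simp add: flat_def)

lemma bump_bounds: "0 \<le> bump a c n x" "bump a c n x \<le> 1"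
  unfolding bump_def
  by (auto intro!: prod_nonneg prod_le_1 mult_le_one mult_nonneg_nonneg flat_nonneg flat_0_le_1)

lemma bump_tendsto_1:
  assumes "x \<in> box a c"
  shows "(\<lambda>n. bump a c n x) \<longlonglongrightarrow> 1"
proof -
  have flat: "(\<lambda>n. flat 0 (real (Suc n) * t)) \<longlonglongrightarrow> 1" if "t > 0" for t
  proof -
    have "(\<lambda>n. exp (- (1 / t) * inverse (real (Suc n)))) \<longlonglongrightarrow> exp (- (1 / t) * 0)"
      by (intro tendsto_exp tendsto_mult tendsto_const LIMSEQ_inverse_real_of_nat)
    moreover have "exp (- (1 / t) * inverse (real (Suc n))) = flat 0 (real (Suc n) * t)" for n
    proof -
      have "real (Suc n) * t > 0" using that by simp
      then show ?thesis using that by (auto simp: flat_def field_simps)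
    qed
    ultimately show ?thesis by simp
  qed
  have "(\<lambda>n. bump a c n x) \<longlonglongrightarrow> (\<Prod>b\<in>(Basis::'a set). 1 * 1)"
    unfolding bump_def
  proof (intro tendsto_prod tendsto_mult)
    fix b :: 'a assume "b \<in> Basis"
    then have "x \<bullet> b - a \<bullet> b > 0" "c \<bullet> b - x \<bullet> b > 0"
      using assms by (auto simp: box_def)
    from this[THEN flat]
    show "(\<lambda>n. flat 0 (real (Suc n) * (x \<bullet> b) + - real (Suc n) * (a \<bullet> b))) \<longlonglongrightarrow> 1"
      "(\<lambda>n. flat 0 (- real (Suc n) * (x \<bullet> b) + real (Suc n) * (c \<bullet> b))) \<longlonglongrightarrow> 1"
      by (simp_all add: algebra_simps)
  qed
  then show ?thesis by simp
qed

lemma bump_test_function: "bump a c n \<in> test_functions UNIV"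
proof -
  have "closure {x. bump a c n x \<noteq> 0} \<subseteq> closure (box a c)"
    using bump_eq_0 by (intro closure_mono) blast
  moreover have "compact (closure (box a c))"
    by simp
  ultimately have "compact (closure {x. bump a c n x \<noteq> 0})"
    by (meson bounded_subset closed_closure compact_eq_bounded_closed)
  moreover have "Ck k (bump a c n)" for k
    unfolding bump_def by (intro Ck_prod Ck_mult Ck_flat)
  ultimately show ?thesis
    by (simp add: test_functions_def)
qed

text \<open>The fundamental lemma of the calculus of variations. Dominated convergence along the bumps shows that
the integral over every box vanishes; the measures with densities the positive and the negative part
then agree on boxes, hence everywhere.\<close>

lemma AE_eq_0_if_test_integrals_0:
  fixes w :: "'a::euclidean_space \<Rightarrow> real"
  assumes [measurable]: "w \<in> borel_measurable borel"
    and int: "\<And>a c. integrable lborel (\<lambda>x. indicator (box a c) x * w x)"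
    and test: "\<And>\<phi>. \<phi> \<in> test_functions UNIV \<Longrightarrow> (LINT x|lborel. w x * \<phi> x) = 0"
  shows "AE x in lborel. w x = 0"
proof -
  have box0: "(LINT x|lborel. indicator (box a c) x * w x) = 0" for a c
  proof -
    have [measurable]: "bump a c n \<in> borel_measurable borel" for n
      using bump_test_function[of a c n] 
      by (auto simp: test_functions_def dest!: spec[of _ 0] intro: borel_measurable_continuous_onI)
    have "(\<lambda>n. LINT x|lborel. w x * bump a c n x) \<longlonglongrightarrow> (LINT x|lborel. indicator (box a c) x * w x)"
    proof (rule integral_dominated_convergence[where w="\<lambda>x. norm (indicator (box a c) x * w x)"])
      show "AE x in lborel. (\<lambda>n. w x * bump a c n x) \<longlonglongrightarrow> indicator (box a c) x * w x"
      proof (rule AE_I2)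
        fix x show "(\<lambda>n. w x * bump a c n x) \<longlonglongrightarrow> indicator (box a c) x * w x"
          using tendsto_mult[OF tendsto_const bump_tendsto_1, of x a c "w x"] bump_eq_0[of x a c]
          by (cases "x \<in> box a c") auto
      qed
      show "AE x in lborel. norm (w x * bump a c n x) \<le> norm (indicator (box a c) x * w x)" for n
      proof (rule AE_I2)
        fix x show "norm (w x * bump a c n x) \<le> norm (indicator (box a c) x * w x)"
          using bump_bounds[of a c n x] bump_eq_0[of x a c] mult_left_mono[of "bump a c n x" 1 "\<bar>w x\<bar>"]
          by (cases "x \<in> box a c") (auto simp: abs_mult)
      qed
    qed (use int[of a c] in simp_all)
    moreover have "(LINT x|lborel. w x * bump a c n x) = 0" for n
      by (rule test[OF bump_test_function])
    ultimately show ?thesis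
      by (simp add: LIMSEQ_const_iff)
  qed
  \<comment> \<open>Since \<open>ennreal\<close> sends negative reals to \<open>0\<close>, the densities are the positive and the
    negative part of \<open>w\<close>.\<close>
  let ?P = "density lborel (\<lambda>x. ennreal (w x))" and ?N = "density lborel (\<lambda>x. ennreal (- w x))"
  have fin: "(\<integral>\<^sup>+x. ennreal (w x) * indicator (box a c) x \<partial>lborel) = ennreal (LINT x|lborel. max 0 (indicator (box a c) x * w x))"
    "(\<integral>\<^sup>+x. ennreal (- w x) * indicator (box a c) x \<partial>lborel) = ennreal (LINT x|lborel. max 0 (- (indicator (box a c) x * w x)))" for a c
  proof -
    have "integrable lborel (\<lambda>x. max 0 (indicator (box a c) x * w x))"
      "integrable lborel (\<lambda>x. max 0 (- (indicator (box a c) x * w x)))"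
      by (intro integrable_max integrable_minus int; simp)+
    then show "(\<integral>\<^sup>+x. ennreal (w x) * indicator (box a c) x \<partial>lborel) = ennreal (LINT x|lborel. max 0 (indicator (box a c) x * w x))"
      "(\<integral>\<^sup>+x. ennreal (- w x) * indicator (box a c) x \<partial>lborel) = ennreal (LINT x|lborel. max 0 (- (indicator (box a c) x * w x)))"
      by (simp_all add: nn_integral_eq_integral[symmetric])
         (auto intro!: nn_integral_cong simp: indicator_def max_def ennreal_neg)
  qed
  have eq: "?P = ?N"
  proof (rule measure_eqI_generator_eq)
    let ?E = "range (\<lambda>(a, b). box a b::'a set)"
    show "Int_stable ?E"
      by (auto simp: Int_stable_def box_Int_box)
    show "?E \<subseteq> Pow UNIV" "sets ?P = sigma_sets UNIV ?E" "sets ?N = sigma_sets UNIV ?E"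
      by (simp_all add: borel_eq_box)
    let ?A = "\<lambda>n::nat. box (- (real n *\<^sub>R One)) (real n *\<^sub>R One) :: 'a set"
    show "range ?A \<subseteq> ?E" "(\<Union>i. ?A i) = UNIV"
      unfolding UN_box_eq_UNIV by auto
    show "emeasure ?P (?A i) \<noteq> \<infinity>" for i by (simp add: emeasure_density fin) 
    show "emeasure ?P X = emeasure ?N X" if X: "X \<in> ?E" for X
    proof -
      obtain a c where X: "X = box a c" using X by auto
      have "(LINT x|lborel. max 0 (indicator (box a c) x * w x)) - (LINT x|lborel. max 0 (- (indicator (box a c) x * w x)))
          = (LINT x|lborel. max 0 (indicator (box a c) x * w x) - max 0 (- (indicator (box a c) x * w x)))"
        by (intro Bochner_Integration.integral_diff[symmetric] integrable_max integrable_minus int) auto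
      also have "\<dots> = (LINT x|lborel. indicator (box a c) x * w x)"
        by (intro Bochner_Integration.integral_cong) auto
      finally show ?thesis
        unfolding X by (simp add: emeasure_density fin box0)
    qed
  qed
  have "AE x in lborel. ennreal (w x) = ennreal (- w x)"
    by (rule sigma_finite_measure.density_unique[OF sigma_finite_lborel _ _ eq]) auto
  then show ?thesis
  proof eventually_elim
    case (elim x)
    then show "w x = 0"
      by (cases "0 \<le> w x") (auto simp: ennreal_neg ennreal_eq_0_iff dest: sym)
  qed
qed

section \<open>Gradients, supports and translates of test functions\<close>

lemma test_function_has_derivative:
  assumes "\<phi> \<in> test_functions U"
  shows "(\<phi> has_derivative (\<lambda>h. grad \<phi> x \<bullet> h)) (at x)"
proof -
  have "Ck 1 \<phi>" using assms by (simp add: test_functions_def)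
  then have *: "(\<phi> has_derivative frechet_derivative \<phi> (at x)) (at x)"
    using Ck_has_derivative[of 0 \<phi>] by simp
  then have lin: "linear (frechet_derivative \<phi> (at x))"
    using has_derivative_linear by blast
  have "frechet_derivative \<phi> (at x) h = grad \<phi> x \<bullet> h" for h
  proof -
    have "frechet_derivative \<phi> (at x) h = frechet_derivative \<phi> (at x) (\<Sum>b\<in>Basis. (h \<bullet> b) *\<^sub>R b)"
      by (simp add: euclidean_representation)
    also have "\<dots> = grad \<phi> x \<bullet> h"
      by (simp add: linear_sum[OF lin] linear_cmul[OF lin] grad_def inner_sum_left mult.commute inner_commute[of h])
    finally show ?thesis .
  qed
  then have "frechet_derivative \<phi> (at x) = (\<lambda>h. grad \<phi> x \<bullet> h)" by (rule ext)
  then show ?thesis using * by (simp only:)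
qed

lemma test_function_continuous:
  assumes "\<phi> \<in> test_functions U"
  shows "continuous_on S \<phi>"
proof -
  have "Ck 0 \<phi>" using assms unfolding test_functions_def by blast
  then show ?thesis using continuous_on_subset[of UNIV \<phi> S] by simp
qed

lemma continuous_grad:
  assumes "\<phi> \<in> test_functions U"
  shows "continuous_on S (grad \<phi>)"
proof -
  have "Ck 1 \<phi>" using assms by (simp add: test_functions_def)
  then have "continuous_on UNIV (\<lambda>x. frechet_derivative \<phi> (at x) b)" if "b \<in> Basis" for b
    using that by simp
  then show ?thesis
    unfolding grad_def[abs_def]
    by (intro continuous_on_sum continuous_on_scaleR continuous_on_const)
       (auto intro: continuous_on_subset)
qed

lemma test_function_measurable:
  assumes "\<phi> \<in> test_functions U"
  shows "\<phi> \<in> borel_measurable borel" "grad \<phi> \<in> borel_measurable borel"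
  using test_function_continuous[OF assms] continuous_grad[OF assms]
  by (auto intro: borel_measurable_continuous_onI)

lemma grad_unique:
  assumes "(\<phi> has_derivative (\<lambda>h. G \<bullet> h)) (at x)"
  shows "grad \<phi> x = G"
proof -
  have "frechet_derivative \<phi> (at x) = (\<lambda>h. G \<bullet> h)"
    using frechet_derivative_at[OF assms] by simp
  then show ?thesis
    by (simp add: grad_def euclidean_representation)
qed

lemma grad_eq_0_outside:
  assumes "x \<notin> closure {x. \<phi> x \<noteq> 0}"
  shows "grad \<phi> x = 0"
proof (rule grad_unique, rule has_derivative_transform_within_open)
  show "((\<lambda>x. 0) has_derivative (\<lambda>h. 0 \<bullet> h)) (at x)" by simp
  show "open (- closure {x. \<phi> x \<noteq> 0})" by (rule open_Compl[OF closed_closure])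
  show "x \<in> - closure {x. \<phi> x \<noteq> 0}" using assms by simp
  show "0 = \<phi> y" if "y \<in> - closure {x. \<phi> x \<noteq> 0}" for y
    using that closure_subset[of "{x. \<phi> x \<noteq> 0}"] by auto
qed

text \<open>The bounds come from continuity on the compact support, outside of which the gradient vanishes too.\<close>

lemma test_function_bounded:
  assumes "\<phi> \<in> test_functions U"
  obtains R M where "0 \<le> M" "0 \<le> R" "\<And>x. \<bar>\<phi> x\<bar> \<le> M" "\<And>x. norm (grad \<phi> x) \<le> M"
    "\<And>x. R < norm x \<Longrightarrow> \<phi> x = 0" "\<And>x. R < norm x \<Longrightarrow> grad \<phi> x = 0"
proof -
  let ?K = "closure {x. \<phi> x \<noteq> 0}"
  have K: "compact ?K" using assms by (simp add: test_functions_def)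
  have out: "\<phi> x = 0" "grad \<phi> x = 0" if "x \<notin> ?K" for x
    using grad_eq_0_outside[OF that] that closure_subset[of "{x. \<phi> x \<noteq> 0}"] by auto
  have "bounded ?K" using K by (rule compact_imp_bounded)
  then obtain R where R: "\<And>x. x \<in> ?K \<Longrightarrow> norm x \<le> R" by (auto simp: bounded_iff)
  have "bounded (\<phi> ` ?K)" "bounded (grad \<phi> ` ?K)"
    using K test_function_continuous[OF assms] continuous_grad[OF assms]
    by (auto intro!: compact_imp_bounded compact_continuous_image)
  then obtain M1 M2 where M: "\<And>x. x \<in> ?K \<Longrightarrow> \<bar>\<phi> x\<bar> \<le> M1" "\<And>x. x \<in> ?K \<Longrightarrow> norm (grad \<phi> x) \<le> M2"
    by (auto simp: bounded_iff)
  show thesis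
  proof (rule that[of "max 0 (max M1 M2)" "max 0 R"])
    fix x
    show "\<bar>\<phi> x\<bar> \<le> max 0 (max M1 M2)"
      using M(1)[of x] out(1)[of x] by (cases "x \<in> ?K") auto
    show "norm (grad \<phi> x) \<le> max 0 (max M1 M2)"
      using M(2)[of x] out(2)[of x] by (cases "x \<in> ?K") auto
    show "max 0 R < norm x \<Longrightarrow> \<phi> x = 0" "max 0 R < norm x \<Longrightarrow> grad \<phi> x = 0"
      using R[of x] out[of x] by (cases "x \<in> ?K"; force)+
  qed auto
qed

lemma grad_translate:
  assumes "\<phi> \<in> test_functions U"
  shows "grad (\<lambda>x. \<phi> (x + a)) x = grad \<phi> (x + a)"
proof (rule grad_unique)
  show "((\<lambda>x. \<phi> (x + a)) has_derivative (\<lambda>h. grad \<phi> (x + a) \<bullet> h)) (at x)"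
    by (rule has_derivative_compose[where g=\<phi> and f="\<lambda>x. x + a" and f'="\<lambda>h. h"])
       (auto intro!: derivative_eq_intros test_function_has_derivative[OF assms])
qed

lemma translate_test_function:
  assumes "\<phi> \<in> test_functions UNIV"
  shows "(\<lambda>x. \<phi> (x + a)) \<in> test_functions UNIV"
proof -
  obtain M R where R: "\<And>x. R < norm x \<Longrightarrow> \<phi> x = 0"
    using test_function_bounded[OF assms] by metis
  have "{x. \<phi> (x + a) \<noteq> 0} \<subseteq> cball (- a) R"
  proof
    fix x assume "x \<in> {x. \<phi> (x + a) \<noteq> 0}"
    then have "norm (x + a) \<le> R" using R[of "x + a"] by force
    moreover have "dist (- a) x = norm (x + a)"
      unfolding dist_norm by (subst norm_minus_cancel[symmetric]) (simp del: norm_minus_cancel)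
    ultimately show "x \<in> cball (- a) R" by simp
  qed
  then have "bounded {x. \<phi> (x + a) \<noteq> 0}"
    using bounded_cball bounded_subset by blast
  then show ?thesis
    using assms by (auto simp: test_functions_def compact_closure intro: Ck_translate)
qed

lemma test_function_FTC:
  assumes "\<phi> \<in> test_functions U"
  shows "has_bochner_integral lborel (\<lambda>t. (grad \<phi> (x + t *\<^sub>R h) \<bullet> h) * indicator {0..1} t) (\<phi> (x + h) - \<phi> x)"
proof -
  have "((\<lambda>t. \<phi> (x + t *\<^sub>R h)) has_real_derivative (grad \<phi> (x + t *\<^sub>R h) \<bullet> h)) (at t)" for t
  proof -
    have "((\<lambda>t. \<phi> (x + t *\<^sub>R h)) has_derivative (\<lambda>s. grad \<phi> (x + t *\<^sub>R h) \<bullet> (s *\<^sub>R h))) (at t)"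
      by (rule has_derivative_compose[where g=\<phi>])
         (auto intro!: derivative_eq_intros test_function_has_derivative[OF assms])
    then show ?thesis
      unfolding has_field_derivative_def by (rule has_derivative_eq_rhs) (simp add: fun_eq_iff mult.commute)
  qed
  moreover have "isCont (\<lambda>t. grad \<phi> (x + t *\<^sub>R h) \<bullet> h) t" for t
  proof -
    have "continuous_on UNIV (\<lambda>t. grad \<phi> (x + t *\<^sub>R h) \<bullet> h)"
      by (intro continuous_intros continuous_on_compose2[OF continuous_grad[OF assms, of UNIV]]) auto
    then show ?thesis by (simp add: continuous_on_eq_continuous_at)
  qed
  ultimately show ?thesis
    using has_bochner_integral_FTC_Icc_real[of 0 1 "\<lambda>t. \<phi> (x + t *\<^sub>R h)" "\<lambda>t. grad \<phi> (x + t *\<^sub>R h) \<bullet> h"] by simp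
qed

section \<open>Estimates for translations\<close>

lemma nn_integral_translate:
  fixes a :: "'a::euclidean_space"
  assumes [measurable]: "f \<in> borel_measurable borel"
  shows "(\<integral>\<^sup>+x. f (x + a) \<partial>lborel) = (\<integral>\<^sup>+x. f x \<partial>lborel)"
proof -
  have "(\<integral>\<^sup>+x. f x \<partial>lborel) = (\<integral>\<^sup>+x. f x \<partial>(distr lborel borel ((+) a)))"
    by (simp add: lborel_distr_plus)
  also have "\<dots> = (\<integral>\<^sup>+x. f (a + x) \<partial>lborel)"
    by (rule nn_integral_distr) auto
  finally show ?thesis by (simp add: add.commute)
qed

lemma integral_translate:
  fixes a :: "'a::euclidean_space" and f :: "'a \<Rightarrow> real"
  assumes [measurable]: "f \<in> borel_measurable borel"
  shows "(LINT x|lborel. f (x + a)) = (LINT x|lborel. f x)"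
    "integrable lborel (\<lambda>x. f (x + a)) \<longleftrightarrow> integrable lborel f"
proof -
  have "(LINT x|lborel. f x) = (LINT x|distr lborel borel ((+) a). f x)"
    by (simp add: lborel_distr_plus)
  also have "\<dots> = (LINT x|lborel. f (a + x))"
    by (rule integral_distr) auto
  finally show "(LINT x|lborel. f (x + a)) = (LINT x|lborel. f x)" by (simp add: add.commute)
  have "integrable lborel f \<longleftrightarrow> integrable (distr lborel borel ((+) a)) f"
    by (simp add: lborel_distr_plus)
  also have "\<dots> \<longleftrightarrow> integrable lborel (\<lambda>x. f (a + x))"
    by (rule integrable_distr_eq) auto
  finally show "integrable lborel (\<lambda>x. f (x + a)) \<longleftrightarrow> integrable lborel f"
    by (simp add: add.commute)
qed

text \<open>This pointwise bound stands in for Jensen's and Hoelder's inequalities below, where the value of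
the constant is irrelevant.\<close>

lemma le_add_powr:
  fixes a :: real
  assumes "0 \<le> a" "0 < l" "1 < p"
  shows "a \<le> l + l powr (1 - p) * a powr p"
proof (cases "a \<le> l")
  case True
  then show ?thesis by (simp add: add_increasing2)
next
  case False
  then have "a powr 1 = a powr (1 - p) * a powr p"
    by (subst powr_add[symmetric]) simp
  moreover have "a powr (1 - p) \<le> l powr (1 - p)"
    using False assms by (intro powr_mono2') auto
  ultimately have "a \<le> l powr (1 - p) * a powr p"
    using mult_right_mono[of "a powr (1 - p)" "l powr (1 - p)" "a powr p"] assms by simp
  then show ?thesis using assms by simp
qed

text \<open>Jensen's inequality on the unit interval, up to a constant. Integrating \<open>le_add_powr\<close> gives
\<open>c \<le> l + l powr (1 - p) * r\<close> for every \<open>l > 0\<close>, where \<open>r\<close> is the integral of \<open>a powr p\<close>;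
the choice \<open>l = r powr (1 / p)\<close> makes both terms equal.\<close>

lemma powr_integral_le:
  fixes a :: "real \<Rightarrow> real" and p c :: real
  assumes [measurable]: "a \<in> borel_measurable borel" and a: "\<And>t. 0 \<le> a t" and p: "1 < p"
    and c: "0 \<le> c" "ennreal c \<le> (\<integral>\<^sup>+t. ennreal (a t) * indicator {0..1} t \<partial>lborel)"
  shows "ennreal (c powr p) \<le> ennreal (2 powr p) * (\<integral>\<^sup>+t. ennreal (a t powr p) * indicator {0..1} t \<partial>lborel)"
proof (cases "(\<integral>\<^sup>+t. ennreal (a t powr p) * indicator {0..1} t \<partial>lborel)" rule: ennreal_cases)
  case top
  then show ?thesis by (simp add: ennreal_mult_top)
next
  case (real r)
  have bound: "c \<le> l + l powr (1 - p) * r" if l: "l > 0" for l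
  proof -
    have "ennreal c \<le> (\<integral>\<^sup>+t. ennreal l * indicator {0..1} t + ennreal (l powr (1 - p)) * (ennreal (a t powr p) * indicator {0..1} t) \<partial>lborel)"
      using a by (intro c(2)[THEN order_trans] nn_integral_mono)
        (auto split: split_indicator simp: ennreal_mult[symmetric] ennreal_plus[symmetric] l less_imp_le 
              intro!: ennreal_leI le_add_powr l p simp del: ennreal_plus)
    also have "\<dots> = ennreal l + ennreal (l powr (1 - p)) * ennreal r"
      by (subst nn_integral_add) (auto simp: nn_integral_cmult real nn_integral_cmult_indicator)
    also have "\<dots> = ennreal (l + l powr (1 - p) * r)"
      using real l by (simp add: ennreal_mult)
    finally show ?thesis using real l by (subst (asm) ennreal_le_iff) auto
  qed
  have "c powr p \<le> 2 powr p * r"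
  proof (cases "r = 0")
    case True
    have "c \<le> 0 + e" if "e > 0" for e
      using bound[OF that] True by simp
    then have "c \<le> 0" by (rule field_le_epsilon)
    then show ?thesis using c p True by simp
  next
    case False
    \<comment> \<open>This \<open>l\<close> satisfies \<open>l = l powr (1 - p) * r\<close>, which turns the bound into \<open>2 * l\<close>.\<close>
    define l where "l = r powr (1 / p)"
    have "l > 0" using False by (simp add: l_def)
    have "l powr (1 - p) * r = l powr (1 - p) * l powr p"
      using False real p by (simp add: l_def powr_powr)
    also have "\<dots> = l" using \<open>l > 0\<close> by (simp add: powr_add[symmetric])
    finally have "c \<le> 2 * l" using bound[OF \<open>l > 0\<close>] by simp
    then have "c powr p \<le> (2 * l) powr p"
      using c p by (intro powr_mono2) auto
    also have "\<dots> = 2 powr p * r"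
      using \<open>l > 0\<close> False real p by (simp add: powr_mult l_def powr_powr)
    finally show ?thesis .
  qed
  then show ?thesis
    using real by (simp add: ennreal_mult[symmetric] ennreal_leI)
qed

text \<open>The difference quotient estimate for Sobolev functions in localized form: \<open>G\<close> takes the place of
\<open>norm (grad v) powr p\<close>, and only the set \<open>B\<close> swept by the segments that start in \<open>A\<close> matters.
The localization is what later allows the integral of \<open>G\<close> to be taken over a thin strip.\<close>

definition translation_bound :: "real \<Rightarrow> ('a::euclidean_space \<Rightarrow> real) \<Rightarrow> ('a \<Rightarrow> ennreal) \<Rightarrow> bool" where
  "translation_bound p v G \<longleftrightarrow> (\<forall>h. \<forall>A\<in>sets borel. \<forall>B\<in>sets borel.
     (\<forall>x\<in>A. \<forall>t\<in>{0..1}. x + t *\<^sub>R h \<in> B) \<longrightarrow>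
     (\<integral>\<^sup>+x. ennreal (\<bar>v (x + h) - v x\<bar> powr p) * indicator A x \<partial>lborel)
       \<le> ennreal (norm h powr p) * (\<integral>\<^sup>+x. G x * indicator B x \<partial>lborel))"

text \<open>The inequality \<open>powr_integral_le\<close> on each segment, then Tonelli and translation invariance: for
every fixed \<open>t\<close> the points \<open>x + t * h\<close> with \<open>x \<in> A\<close> lie in \<open>B\<close>.\<close>

lemma translation_bound_if_line_integral_bound:
  fixes w q :: "'a::euclidean_space \<Rightarrow> real"
  assumes [measurable]: "w \<in> borel_measurable borel" "q \<in> borel_measurable borel"
    and q: "\<And>x. 0 \<le> q x" and p: "1 < p"
    and line: "\<And>h. AE x in lborel. ennreal \<bar>w (x + h) - w x\<bar>
         \<le> (\<integral>\<^sup>+t. ennreal (norm h * q (x + t *\<^sub>R h)) * indicator {0..1} t \<partial>lborel)"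
  shows "translation_bound p w (\<lambda>x. ennreal (2 powr p * q x powr p))"
  unfolding translation_bound_def
proof (intro allI ballI impI)
  fix h :: 'a and A B :: "'a set"
  assume [measurable]: "A \<in> sets borel" "B \<in> sets borel"
    and AB: "\<forall>x\<in>A. \<forall>t\<in>{0..1}. x + t *\<^sub>R h \<in> B"
  let ?c = "ennreal (2 powr p)"
  let ?F = "\<lambda>x. ennreal ((norm h * q x) powr p) * indicator B x"
  have "(\<integral>\<^sup>+x. ennreal (\<bar>w (x + h) - w x\<bar> powr p) * indicator A x \<partial>lborel)
      \<le> (\<integral>\<^sup>+x. ?c * (\<integral>\<^sup>+t. ?F (x + t *\<^sub>R h) * indicator {0..1} t \<partial>lborel) \<partial>lborel)"
  proof (rule nn_integral_mono_AE)
    show "AE x in lborel. ennreal (\<bar>w (x + h) - w x\<bar> powr p) * indicator A x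
       \<le> ?c * (\<integral>\<^sup>+t. ?F (x + t *\<^sub>R h) * indicator {0..1} t \<partial>lborel)"
      using line[of h]
    proof eventually_elim
      case (elim x)
      show ?case
      proof (cases "x \<in> A")
        case True
        have "ennreal (\<bar>w (x + h) - w x\<bar> powr p)
            \<le> ?c * (\<integral>\<^sup>+t. ennreal ((norm h * q (x + t *\<^sub>R h)) powr p) * indicator {0..1} t \<partial>lborel)"
          by (rule powr_integral_le[OF _ _ p _ elim]) (measurable, simp_all add: q)
        also have "(\<integral>\<^sup>+t. ennreal ((norm h * q (x + t *\<^sub>R h)) powr p) * indicator {0..1} t \<partial>lborel)
           = (\<integral>\<^sup>+t. ?F (x + t *\<^sub>R h) * indicator {0..1} t \<partial>lborel)"
          using AB True by (intro nn_integral_cong) (auto split: split_indicator)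
        finally show ?thesis using True by simp
      qed simp
    qed
  qed
  also have "\<dots> = ?c * (\<integral>\<^sup>+x. (\<integral>\<^sup>+t. ?F (x + t *\<^sub>R h) * indicator {0..1} t \<partial>lborel) \<partial>lborel)"
    by (rule nn_integral_cmult) measurable
  also have "(\<integral>\<^sup>+x. (\<integral>\<^sup>+t. ?F (x + t *\<^sub>R h) * indicator {0..1} t \<partial>lborel) \<partial>lborel)
      = (\<integral>\<^sup>+t. (\<integral>\<^sup>+x. ?F (x + t *\<^sub>R h) * indicator {0..1} t \<partial>lborel) \<partial>lborel)"
    by (rule lborel_pair.Fubini'[symmetric]) measurable
  also have "\<dots> = (\<integral>\<^sup>+t. (\<integral>\<^sup>+x. ?F x \<partial>lborel) * indicator {0..1::real} t \<partial>lborel)"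
    by (subst nn_integral_multc, measurable, subst nn_integral_translate) (auto intro!: nn_integral_cong)
  also have "\<dots> = (\<integral>\<^sup>+x. ?F x \<partial>lborel)"
    by (simp add: nn_integral_cmult_indicator)
  also have "\<dots> = (\<integral>\<^sup>+x. ennreal (norm h powr p) * (ennreal (q x powr p) * indicator B x) \<partial>lborel)"
    using q by (intro nn_integral_cong) (simp add: powr_mult ennreal_mult mult.assoc)
  also have "\<dots> = ennreal (norm h powr p) * (\<integral>\<^sup>+x. ennreal (q x powr p) * indicator B x \<partial>lborel)"
    by (rule nn_integral_cmult) measurable
  also have "?c * \<dots> = ennreal (norm h powr p) * (\<integral>\<^sup>+x. ?c * (ennreal (q x powr p) * indicator B x) \<partial>lborel)"
    by (subst nn_integral_cmult) (auto simp: mult.left_commute)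
  also have "\<dots> = ennreal (norm h powr p) * (\<integral>\<^sup>+x. ennreal (2 powr p * q x powr p) * indicator B x \<partial>lborel)"
    by (simp add: ennreal_mult mult.assoc)
  finally show "(\<integral>\<^sup>+x. ennreal (\<bar>w (x + h) - w x\<bar> powr p) * indicator A x \<partial>lborel)
       \<le> ennreal (norm h powr p) * (\<integral>\<^sup>+x. ennreal (2 powr p * q x powr p) * indicator B x \<partial>lborel)" .
qed

lemma test_function_translation_bound:
  fixes \<phi> :: "'a::euclidean_space \<Rightarrow> real"
  assumes \<phi>: "\<phi> \<in> test_functions U" and p: "1 < p"
  shows "translation_bound p \<phi> (\<lambda>x. ennreal (2 powr p * norm (grad \<phi> x) powr p))"
proof (rule translation_bound_if_line_integral_bound[OF _ _ _ p])
  note [measurable] = test_function_measurable[OF \<phi>]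
  show "\<phi> \<in> borel_measurable borel" "(\<lambda>x. norm (grad \<phi> x)) \<in> borel_measurable borel" by measurable
  show "AE x in lborel. ennreal \<bar>\<phi> (x + h) - \<phi> x\<bar>
         \<le> (\<integral>\<^sup>+t. ennreal (norm h * norm (grad \<phi> (x + t *\<^sub>R h))) * indicator {0..1} t \<partial>lborel)" for h
  proof (rule AE_I2)
    fix x
    note FTC = test_function_FTC[OF \<phi>, of x h, unfolded has_bochner_integral_iff]
    have "ennreal \<bar>\<phi> (x + h) - \<phi> x\<bar> \<le> (\<integral>\<^sup>+t. norm ((grad \<phi> (x + t *\<^sub>R h) \<bullet> h) * indicator {0..1} t) \<partial>lborel)"
      using integral_norm_bound_ennreal[of lborel "\<lambda>t. (grad \<phi> (x + t *\<^sub>R h) \<bullet> h) * indicator {0..1} t"] FTC by simp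
    also have "\<dots> \<le> (\<integral>\<^sup>+t. ennreal (norm h * norm (grad \<phi> (x + t *\<^sub>R h))) * indicator {0..1} t \<partial>lborel)"
      using Cauchy_Schwarz_ineq2[of _ h]
      by (intro nn_integral_mono) (auto split: split_indicator intro!: ennreal_leI simp: mult.commute[of "norm h"])
    finally show "ennreal \<bar>\<phi> (x + h) - \<phi> x\<bar>
         \<le> (\<integral>\<^sup>+t. ennreal (norm h * norm (grad \<phi> (x + t *\<^sub>R h))) * indicator {0..1} t \<partial>lborel)" .
  qed
qed auto

section \<open>Sobolev functions as line integrals of their weak gradients\<close>

lemma measurable_cball [measurable]: "cball a r \<in> sets (borel :: 'a::euclidean_space measure)"
  by simp

lemma integrable_cball_if_powr_integrable:
  fixes f :: "'a::euclidean_space \<Rightarrow> real"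
  assumes [measurable]: "f \<in> borel_measurable borel"
    and "1 < p" "integrable lborel (\<lambda>x. \<bar>f x\<bar> powr p)"
  shows "integrable lborel (\<lambda>x. indicator (cball 0 R) x * f x)"
proof (rule Bochner_Integration.integrable_bound)
  have "integrable lborel (indicator (cball 0 R :: 'a set) :: 'a \<Rightarrow> real)"
    using emeasure_bounded_finite[OF bounded_cball, of "0 :: 'a" R] by (simp add: integrable_indicator_iff)
  then show "integrable lborel (\<lambda>x. indicator (cball 0 R) x + \<bar>f x\<bar> powr p)"
    using assms by (intro Bochner_Integration.integrable_add)
  show "AE x in lborel. norm (indicator (cball 0 R) x * f x) \<le> norm (indicator (cball 0 R) x + \<bar>f x\<bar> powr p)"
    using le_add_powr[of "\<bar>f _\<bar>" 1 p] assms(2) by (intro AE_I2) (auto split: split_indicator)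
qed measurable

text \<open>Justifies the applications of Fubini below. For fixed \<open>t\<close> a translation moves the whole shift onto
the bounded factor \<open>\<psi>\<close>, which vanishes outside a ball whose radius does not depend on \<open>t\<close>.\<close>

lemma integrable_along_lines:
  fixes f \<psi> :: "'a::euclidean_space \<Rightarrow> real"
  assumes [measurable]: "f \<in> borel_measurable borel" "\<psi> \<in> borel_measurable borel"
    and loc: "\<And>R. integrable lborel (\<lambda>x. indicator (cball 0 R) x * f x)"
    and \<psi>: "\<And>x. \<bar>\<psi> x\<bar> \<le> M" "\<And>x. R < norm x \<Longrightarrow> \<psi> x = 0"
    and ab: "\<bar>b - a\<bar> \<le> 1"
  shows "integrable (lborel \<Otimes>\<^sub>M lborel)
    (\<lambda>(x, t). indicator {0..1} t * (f (x + (a * t) *\<^sub>R h) * \<psi> (x + (b * t) *\<^sub>R h)))"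
proof (rule integrableI_bounded)
  let ?k = "\<lambda>(x, t). indicator {0..1} t * (f (x + (a * t) *\<^sub>R h) * \<psi> (x + (b * t) *\<^sub>R h)) :: real"
  show [measurable]: "?k \<in> borel_measurable (lborel \<Otimes>\<^sub>M lborel)" by measurable
  have M: "0 \<le> M" using \<psi>(1)[of 0] by linarith
  let ?I = "\<integral>\<^sup>+x. ennreal (norm (indicator (cball 0 (R + norm h)) x * f x)) \<partial>lborel"
  have "(\<integral>\<^sup>+z. ennreal (norm (?k z)) \<partial>(lborel \<Otimes>\<^sub>M lborel))
      = (\<integral>\<^sup>+t. (\<integral>\<^sup>+x. ennreal (norm (?k (x, t))) \<partial>lborel) \<partial>lborel)"
    by (rule lborel_pair.nn_integral_snd[symmetric]) measurable
  also have "\<dots> \<le> (\<integral>\<^sup>+t. ennreal M * ?I * indicator {0..1::real} t \<partial>lborel)"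
  proof (intro nn_integral_mono)
    fix t :: real
    show "(\<integral>\<^sup>+x. ennreal (norm (?k (x, t))) \<partial>lborel) \<le> ennreal M * ?I * indicator {0..1::real} t"
    proof (cases "t \<in> {0..1}")
      case True
      have "(\<integral>\<^sup>+x. ennreal (norm (?k (x, t))) \<partial>lborel)
          = (\<integral>\<^sup>+x. (\<lambda>x. ennreal (norm (f x * \<psi> (x + ((b - a) * t) *\<^sub>R h)))) (x + (a * t) *\<^sub>R h) \<partial>lborel)"
        using True by (simp add: algebra_simps)
      also have "\<dots> = (\<integral>\<^sup>+x. ennreal (norm (f x * \<psi> (x + ((b - a) * t) *\<^sub>R h))) \<partial>lborel)"
        by (rule nn_integral_translate) measurable
      also have "\<dots> \<le> (\<integral>\<^sup>+x. ennreal M * ennreal (norm (indicator (cball 0 (R + norm h)) x * f x)) \<partial>lborel)"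
      proof (intro nn_integral_mono)
        fix x
        show "ennreal (norm (f x * \<psi> (x + ((b - a) * t) *\<^sub>R h)))
            \<le> ennreal M * ennreal (norm (indicator (cball 0 (R + norm h)) x * f x))"
        proof (cases "x \<in> cball 0 (R + norm h)")
          case True
          then show ?thesis
            using \<psi>(1)[of "x + ((b - a) * t) *\<^sub>R h"] M
            by (auto simp: ennreal_mult[symmetric] abs_mult mult.commute[of M] intro!: ennreal_leI mult_left_mono)
        next
          case False
          have "norm (((b - a) * t) *\<^sub>R h) \<le> 1 * norm h"
            unfolding norm_scaleR abs_mult using ab \<open>t \<in> {0..1}\<close>
            by (intro mult_right_mono mult_le_one) auto
          moreover have "norm x \<le> norm (x + ((b - a) * t) *\<^sub>R h) + norm (((b - a) * t) *\<^sub>R h)"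
            by (metis add_diff_cancel norm_triangle_ineq4)
          ultimately have "R < norm (x + ((b - a) * t) *\<^sub>R h)"
            using False by simp
          then show ?thesis using \<psi>(2) by simp
        qed
      qed
      also have "\<dots> = ennreal M * ?I"
        by (rule nn_integral_cmult) measurable
      finally show ?thesis using True by simp
    qed simp
  qed
  also have "\<dots> = ennreal M * ?I"
    by (simp add: nn_integral_cmult_indicator)
  also have "\<dots> < \<infinity>"
    using loc[of "R + norm h"] by (simp add: integrable_iff_bounded ennreal_mult_less_top)
  finally show "(\<integral>\<^sup>+z. ennreal (norm (?k z)) \<partial>(lborel \<Otimes>\<^sub>M lborel)) < \<infinity>" .
qed

lemma integrable_mult_test:
  fixes f \<psi> :: "'a::euclidean_space \<Rightarrow> real"
  assumes [measurable]: "f \<in> borel_measurable borel" "\<psi> \<in> borel_measurable borel"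
    and loc: "\<And>R. integrable lborel (\<lambda>x. indicator (cball 0 R) x * f x)"
    and \<psi>: "\<And>x. \<bar>\<psi> x\<bar> \<le> M" "\<And>x. R < norm x \<Longrightarrow> \<psi> x = 0"
  shows "integrable lborel (\<lambda>x. f x * \<psi> x)"
proof (rule Bochner_Integration.integrable_bound)
  show "integrable lborel (\<lambda>x. M * (indicator (cball 0 R) x * f x))"
    using loc by simp
  have M: "0 \<le> M" using \<psi>(1)[of 0] by linarith
  show "AE x in lborel. norm (f x * \<psi> x) \<le> norm (M * (indicator (cball 0 R) x * f x))"
  proof (rule AE_I2)
    fix x
    show "norm (f x * \<psi> x) \<le> norm (M * (indicator (cball 0 R) x * f x))"
      using \<psi>[of x] M mult_right_mono[of "\<bar>\<psi> x\<bar>" M "\<bar>f x\<bar>"]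
      by (cases "R < norm x") (auto simp: abs_mult mult.commute)
  qed
qed measurable

text \<open>By the fundamental lemma it suffices to test both sides against an arbitrary \<open>\<phi>\<close>. Moving the translation to \<open>\<phi>\<close> gives the integral of
\<open>v(x) * (\<phi>(x - h) - \<phi>(x))\<close>; this difference of \<open>\<phi>\<close> is a line integral of
\<open>grad \<phi>\<close>. After Fubini the weak gradient can be brought in for each \<open>t\<close>, since translates of
test functions are test functions, and moving the translations back yields the line integral of \<open>g\<close>.\<close>

lemma weak_gradient_line_integral:
  fixes v :: "'a::euclidean_space \<Rightarrow> real" and g :: "'a \<Rightarrow> 'a" and h :: 'a
  assumes meas [measurable]: "v \<in> borel_measurable borel" "g \<in> borel_measurable borel"
    and vloc: "\<And>R. integrable lborel (\<lambda>x. indicator (cball 0 R) x * v x)"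
    and gloc: "\<And>R h. integrable lborel (\<lambda>x. indicator (cball 0 R) x * (g x \<bullet> h))"
    and weak: "\<And>\<phi> b. \<phi> \<in> test_functions UNIV \<Longrightarrow> b \<in> Basis \<Longrightarrow>
      (LINT x|lborel. v x * (grad \<phi> x \<bullet> b)) = - (LINT x|lborel. (g x \<bullet> b) * \<phi> x)"
  shows "AE x in lborel. v (x + h) - v x = (LINT t|lborel. indicator {0..1} t * (g (x + t *\<^sub>R h) \<bullet> h))"
proof -
  have weak_h: "(LINT x|lborel. v x * (grad \<phi> x \<bullet> h)) = - (LINT x|lborel. (g x \<bullet> h) * \<phi> x)"
    if \<phi>: "\<phi> \<in> test_functions UNIV" for \<phi>
  proof -
    note [measurable] = test_function_measurable[OF \<phi>]
    obtain R M where RM: "\<And>x. \<bar>\<phi> x\<bar> \<le> M" "\<And>x. norm (grad \<phi> x) \<le> M"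
      "\<And>x. R < norm x \<Longrightarrow> \<phi> x = 0" "\<And>x. R < norm x \<Longrightarrow> grad \<phi> x = 0"
      using test_function_bounded[OF \<phi>] by metis
    have i1: "integrable lborel (\<lambda>x. v x * (grad \<phi> x \<bullet> b))" if "b \<in> Basis" for b
      by (rule integrable_mult_test[where M=M and R=R]) (use RM that vloc in \<open>auto intro: order_trans[OF Basis_le_norm]\<close>)
    have i2: "integrable lborel (\<lambda>x. (g x \<bullet> b) * \<phi> x)" for b
      by (rule integrable_mult_test[where M=M and R=R]) (use RM gloc in auto)
    have "(LINT x|lborel. v x * (grad \<phi> x \<bullet> h)) = (LINT x|lborel. (\<Sum>b\<in>Basis. (h \<bullet> b) * (v x * (grad \<phi> x \<bullet> b))))"
      by (intro Bochner_Integration.integral_cong refl, subst euclidean_inner) (simp add: sum_distrib_left mult_ac)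
    also have "\<dots> = (\<Sum>b\<in>Basis. (h \<bullet> b) * (LINT x|lborel. v x * (grad \<phi> x \<bullet> b)))"
      using i1 by (subst Bochner_Integration.integral_sum) auto
    also have "\<dots> = - (\<Sum>b\<in>Basis. (h \<bullet> b) * (LINT x|lborel. (g x \<bullet> b) * \<phi> x))"
      by (simp add: weak[OF \<phi>] sum_negf)
    also have "(\<Sum>b\<in>Basis. (h \<bullet> b) * (LINT x|lborel. (g x \<bullet> b) * \<phi> x))
        = (LINT x|lborel. (\<Sum>b\<in>Basis. (h \<bullet> b) * ((g x \<bullet> b) * \<phi> x)))"
      using i2 by (subst Bochner_Integration.integral_sum) auto
    also have "\<dots> = (LINT x|lborel. (g x \<bullet> h) * \<phi> x)"
      by (intro Bochner_Integration.integral_cong refl) (simp add: euclidean_inner[of "g _" h] sum_distrib_left mult_ac)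
    finally show ?thesis .
  qed
  define D where "D x = (LINT t|lborel. indicator {0..1} t * (g (x + t *\<^sub>R h) \<bullet> h))" for x
  have [measurable]: "D \<in> borel_measurable borel"
    unfolding D_def by measurable
  have vh: "integrable lborel (\<lambda>x. v (x + h) * \<psi> x)"
    if [measurable]: "\<psi> \<in> borel_measurable borel" and \<psi>: "\<And>x. \<bar>\<psi> x\<bar> \<le> M" "\<And>x. R < norm x \<Longrightarrow> \<psi> x = 0" for \<psi> M R
  proof -
    have "integrable lborel (\<lambda>x. v x * \<psi> (x + (- h)))"
    proof (rule integrable_mult_test[where M=M and R="R + norm h"])
      fix x :: 'a assume "R + norm h < norm x"
      then have "R < norm (x + (- h))" using norm_triangle_ineq2[of x h] by simp
      then show "\<psi> (x + - h) = 0" by (rule \<psi>(2))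
    qed (use \<psi>(1) vloc in auto)
    from this[THEN integral_translate(2)[THEN iffD2, rotated], of h] show ?thesis by simp
  qed
  have Dint: "integrable lborel (\<lambda>x. D x * \<psi> x)"
    and Dswap: "(LINT x|lborel. D x * \<psi> x)
      = (LINT t|lborel. indicator {0..1} t * (LINT x|lborel. (g x \<bullet> h) * \<psi> (x + (- t) *\<^sub>R h)))"
    if [measurable]: "\<psi> \<in> borel_measurable borel" and \<psi>: "\<And>x. \<bar>\<psi> x\<bar> \<le> M" "\<And>x. R < norm x \<Longrightarrow> \<psi> x = 0" for \<psi> M R
  proof -
    have int: "integrable (lborel \<Otimes>\<^sub>M lborel) (\<lambda>(x, t). indicator {0..1} t * ((g (x + t *\<^sub>R h) \<bullet> h) * \<psi> x))"
      using integrable_along_lines[of "\<lambda>x. g x \<bullet> h" \<psi> M R 0 1 h] gloc \<psi> by simp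
    have Dx: "D x * \<psi> x = (LINT t|lborel. indicator {0..1} t * ((g (x + t *\<^sub>R h) \<bullet> h) * \<psi> x))" for x
      unfolding D_def by (subst integral_mult_left_zero[symmetric]) (simp add: mult.assoc)
    show "integrable lborel (\<lambda>x. D x * \<psi> x)"
      using lborel_pair.integrable_fst'[OF int] by (simp add: Dx)
    have "(LINT x|lborel. D x * \<psi> x)
        = (LINT x|lborel. LINT t|lborel. indicator {0..1} t * ((g (x + t *\<^sub>R h) \<bullet> h) * \<psi> x))"
      by (simp add: Dx)
    also have "\<dots> = (LINT t|lborel. LINT x|lborel. indicator {0..1} t * ((g (x + t *\<^sub>R h) \<bullet> h) * \<psi> x))"
      by (rule lborel_pair.Fubini_integral[symmetric, OF int])
    also have "\<dots> = (LINT t|lborel. indicator {0..1} t * (LINT x|lborel. (g x \<bullet> h) * \<psi> (x + (- t) *\<^sub>R h)))"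
    proof (intro Bochner_Integration.integral_cong refl)
      fix t :: real
      have "(LINT x|lborel. (g (x + t *\<^sub>R h) \<bullet> h) * \<psi> x) = (LINT x|lborel. (g x \<bullet> h) * \<psi> (x + (- t) *\<^sub>R h))"
        using integral_translate(1)[of "\<lambda>x. (g x \<bullet> h) * \<psi> (x + (- t) *\<^sub>R h)" "t *\<^sub>R h"] by simp
      then show "(LINT x|lborel. indicator {0..1} t * ((g (x + t *\<^sub>R h) \<bullet> h) * \<psi> x))
        = indicator {0..1} t * (LINT x|lborel. (g x \<bullet> h) * \<psi> (x + (- t) *\<^sub>R h))"
        by simp
    qed
    finally show "(LINT x|lborel. D x * \<psi> x)
      = (LINT t|lborel. indicator {0..1} t * (LINT x|lborel. (g x \<bullet> h) * \<psi> (x + (- t) *\<^sub>R h)))" .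
  qed
  have "AE x in lborel. v (x + h) - v x - D x = 0"
  proof (rule AE_eq_0_if_test_integrals_0)
    show "(\<lambda>x. v (x + h) - v x - D x) \<in> borel_measurable borel" by measurable
    show "integrable lborel (\<lambda>x. indicator (box a c) x * (v (x + h) - v x - D x))" for a c :: 'a
    proof -
      obtain R where R: "box a c \<subseteq> cball 0 R"
        using bounded_box[of a c] by (auto simp: bounded_iff subset_eq)
      let ?i = "indicator (box a c) :: 'a \<Rightarrow> real"
      have b: "?i \<in> borel_measurable borel" "\<And>x. \<bar>?i x\<bar> \<le> 1" "\<And>x. R < norm x \<Longrightarrow> ?i x = 0"
        using R by (auto split: split_indicator)
      have "integrable lborel (\<lambda>x. v (x + h) * ?i x - v x * ?i x - D x * ?i x)"
        by (intro Bochner_Integration.integrable_diff vh[OF b] Dint[OF b] integrable_mult_test[OF _ _ vloc b(2,3)]) auto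
      then show ?thesis
        by (simp add: algebra_simps)
    qed
  next
    fix \<phi> :: "'a \<Rightarrow> real" assume \<phi>: "\<phi> \<in> test_functions UNIV"
    note \<phi>m [measurable] = test_function_measurable[OF \<phi>]
    obtain R M where RM: "\<And>x. \<bar>\<phi> x\<bar> \<le> M" "\<And>x. norm (grad \<phi> x) \<le> M"
      "\<And>x. R < norm x \<Longrightarrow> \<phi> x = 0" "\<And>x. R < norm x \<Longrightarrow> grad \<phi> x = 0"
      using test_function_bounded[OF \<phi>] by metis
    note b = \<phi>m(1) RM(1,3)
    have shift: "(\<lambda>x. \<phi> (x + a)) \<in> borel_measurable borel" "\<And>x. \<bar>\<phi> (x + a)\<bar> \<le> M" "\<And>x. R + norm a < norm x \<Longrightarrow> \<phi> (x + a) = 0" for a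
    proof -
      show "\<phi> (x + a) = 0" if "R + norm a < norm x" for x
      proof (rule RM(3))
        have "norm x \<le> norm (x + a) + norm a" by (metis add_diff_cancel norm_triangle_ineq4)
        then show "R < norm (x + a)" using that by linarith
      qed
    qed (use RM in auto)
    let ?k = "\<lambda>x t. indicator {0..1} t * (v x * (grad \<phi> (x + (- t) *\<^sub>R h) \<bullet> h))"
    have grad_b: "\<bar>grad \<phi> x \<bullet> h\<bar> \<le> M * norm h" for x
      using RM(2)[of x] Cauchy_Schwarz_ineq2[of "grad \<phi> x" h] by (meson mult_right_mono norm_ge_zero order_trans)
    \<comment> \<open>The shift acts on the test function only, hence \<open>a = 0\<close> and \<open>b = -1\<close>
      in \<open>integrable_along_lines\<close>.\<close>
    have kint: "integrable (lborel \<Otimes>\<^sub>M lborel) (\<lambda>(x, t). ?k x t)"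
      using integrable_along_lines[of v "\<lambda>x. grad \<phi> x \<bullet> h" "M * norm h" R "-1" 0 h] vloc RM grad_b by simp
    have "(LINT x|lborel. (v (x + h) - v x) * \<phi> x) = (LINT x|lborel. v (x + h) * \<phi> x) - (LINT x|lborel. v x * \<phi> x)"
      using vh[OF b] integrable_mult_test[OF meas(1) b(1) vloc b(2,3)]
      by (simp add: left_diff_distrib)
    also have "(LINT x|lborel. v (x + h) * \<phi> x) = (LINT x|lborel. v x * \<phi> (x + (- h)))"
      using integral_translate(1)[of "\<lambda>x. v x * \<phi> (x + (- h))" h] by simp
    also have "\<dots> - (LINT x|lborel. v x * \<phi> x) = (LINT x|lborel. v x * (\<phi> (x + (- h)) - \<phi> x))"
      using integrable_mult_test[OF meas(1) shift(1)[of "- h"] vloc shift(2,3)] integrable_mult_test[OF meas(1) b(1) vloc b(2,3)]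
      by (simp add: right_diff_distrib)
    also have "\<dots> = (LINT x|lborel. - (LINT t|lborel. ?k x t))"
    proof (intro Bochner_Integration.integral_cong refl)
      fix x
      have "\<phi> (x + - h) - \<phi> x = (LINT t|lborel. (grad \<phi> (x + t *\<^sub>R (- h)) \<bullet> (- h)) * indicator {0..1} t)"
        by (rule has_bochner_integral_integral_eq[symmetric, OF test_function_FTC[OF \<phi>]])
      then have "v x * (\<phi> (x + - h) - \<phi> x) = (LINT t|lborel. v x * ((grad \<phi> (x + t *\<^sub>R (- h)) \<bullet> (- h)) * indicator {0..1} t))"
        by simp
      also have "\<dots> = (LINT t|lborel. - ?k x t)"
        by (intro Bochner_Integration.integral_cong) (auto simp: algebra_simps)
      finally show "v x * (\<phi> (x + - h) - \<phi> x) = - (LINT t|lborel. ?k x t)"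
        by simp
    qed
    also have "\<dots> = - (LINT t|lborel. LINT x|lborel. ?k x t)"
      using lborel_pair.Fubini_integral[OF kint] by simp
    also have "\<dots> = (LINT t|lborel. indicator {0..1} t * (LINT x|lborel. (g x \<bullet> h) * \<phi> (x + (- t) *\<^sub>R h)))"
    proof -
      have "(LINT x|lborel. ?k x t) = - (indicator {0..1} t * (LINT x|lborel. (g x \<bullet> h) * \<phi> (x + (- t) *\<^sub>R h)))" for t
        using weak_h[OF translate_test_function[OF \<phi>, of "(- t) *\<^sub>R h"]] grad_translate[OF \<phi>, of "(- t) *\<^sub>R h"]
        by simp
      then show ?thesis by simp
    qed
    also have "\<dots> = (LINT x|lborel. D x * \<phi> x)"
      by (rule Dswap[OF b, symmetric])
    finally have eq: "(LINT x|lborel. (v (x + h) - v x) * \<phi> x) = (LINT x|lborel. D x * \<phi> x)" .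
    have "integrable lborel (\<lambda>x. (v (x + h) - v x) * \<phi> x)"
      using vh[OF b] integrable_mult_test[OF meas(1) b(1) vloc b(2,3)] by (simp add: left_diff_distrib)
    then show "(LINT x|lborel. (v (x + h) - v x - D x) * \<phi> x) = 0"
      using eq Dint[OF b] by (subst left_diff_distrib) simp
  qed
  then show ?thesis
    by eventually_elim (simp add: D_def)
qed

lemma weak_gradient_translation_bound:
  fixes v :: "'a::euclidean_space \<Rightarrow> real" and g :: "'a \<Rightarrow> 'a"
  assumes p: "1 < p" and meas [measurable]: "v \<in> borel_measurable borel" "g \<in> borel_measurable borel"
    and v: "integrable lborel (\<lambda>x. \<bar>v x\<bar> powr p)" and g: "integrable lborel (\<lambda>x. norm (g x) powr p)"
    and weak: "\<And>\<phi> b. \<phi> \<in> test_functions UNIV \<Longrightarrow> b \<in> Basis \<Longrightarrow>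
      (LINT x|lborel. v x * (grad \<phi> x \<bullet> b)) = - (LINT x|lborel. (g x \<bullet> b) * \<phi> x)"
  shows "translation_bound p v (\<lambda>x. ennreal (2 powr p * norm (g x) powr p))"
proof (rule translation_bound_if_line_integral_bound[OF _ _ _ p])
  fix h :: 'a
  have vloc: "integrable lborel (\<lambda>x. indicator (cball 0 R) x * v x)" for R
    by (rule integrable_cball_if_powr_integrable[OF _ p v]) measurable
  have gloc: "integrable lborel (\<lambda>x. indicator (cball 0 R) x * (g x \<bullet> h))" for R h
  proof (rule Bochner_Integration.integrable_bound)
    show "integrable lborel (\<lambda>x. (indicator (cball 0 R) x * norm (g x)) * norm h)"
      by (intro integrable_mult_left integrable_cball_if_powr_integrable[OF _ p]) (use g in auto)
    show "AE x in lborel. norm (indicator (cball 0 R) x * (g x \<bullet> h)) \<le> norm ((indicator (cball 0 R) x * norm (g x)) * norm h)"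
      by (intro AE_I2) (auto simp: Cauchy_Schwarz_ineq2 split: split_indicator)
  qed measurable
  show "AE x in lborel. ennreal \<bar>v (x + h) - v x\<bar>
         \<le> (\<integral>\<^sup>+t. ennreal (norm h * norm (g (x + t *\<^sub>R h))) * indicator {0..1} t \<partial>lborel)"
    using weak_gradient_line_integral[OF meas vloc gloc weak, of h, simplified]
  proof eventually_elim
    case (elim x)
    let ?f = "\<lambda>t. indicator {0..1} t * (g (x + t *\<^sub>R h) \<bullet> h)"
    have "ennreal (norm (LINT t|lborel. ?f t)) \<le> (\<integral>\<^sup>+t. norm (?f t) \<partial>lborel)"
      using integral_norm_bound_ennreal[of lborel ?f] 
      by (cases "integrable lborel ?f") (auto simp: not_integrable_integral_eq)
    also have "\<dots> \<le> (\<integral>\<^sup>+t. ennreal (norm h * norm (g (x + t *\<^sub>R h))) * indicator {0..1} t \<partial>lborel)"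
      using Cauchy_Schwarz_ineq2[of _ h]
      by (intro nn_integral_mono) (auto split: split_indicator intro!: ennreal_leI simp: mult.commute[of "norm h"])
    finally show ?case using elim by simp
  qed
qed auto

section \<open>Translation bounds for limits of test functions\<close>

lemma powr_add_le:
  fixes a b c :: real
  assumes "1 < p" "0 \<le> a" "0 \<le> b" "0 \<le> c" "a \<le> b + c"
  shows "a powr p \<le> 2 powr p * (b powr p + c powr p)"
proof -
  have "a powr p \<le> (2 * max b c) powr p"
    using assms by (intro powr_mono2) auto
  also have "\<dots> = 2 powr p * max b c powr p"
    using assms by (simp add: powr_mult)
  also have "max b c powr p \<le> b powr p + c powr p"
    by (auto simp: max_def)
  finally show ?thesis by simp
qed

lemma ennreal_powr_add_le:
  fixes a b c :: real
  assumes "1 < p" "0 \<le> a" "0 \<le> b" "0 \<le> c" "a \<le> b + c"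
  shows "ennreal (a powr p) \<le> ennreal (2 powr p) * (ennreal (b powr p) + ennreal (c powr p))"
  using powr_add_le[OF assms] by (simp add: ennreal_plus[symmetric] ennreal_mult[symmetric] ennreal_leI del: ennreal_plus)

lemma nn_integral_translation_le:
  fixes v :: "'a::euclidean_space \<Rightarrow> real"
  assumes [measurable]: "v \<in> borel_measurable borel" and p: "1 < p"
  shows "(\<integral>\<^sup>+x. ennreal (\<bar>v (x + h) - v x\<bar> powr p) \<partial>lborel)
    \<le> ennreal (2 powr p) * (2 * (\<integral>\<^sup>+x. ennreal (\<bar>v x\<bar> powr p) \<partial>lborel))"
proof -
  have "(\<integral>\<^sup>+x. ennreal (\<bar>v (x + h) - v x\<bar> powr p) \<partial>lborel)
      \<le> (\<integral>\<^sup>+x. ennreal (2 powr p) * (ennreal (\<bar>v (x + h)\<bar> powr p) + ennreal (\<bar>v x\<bar> powr p)) \<partial>lborel)"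
    using p by (intro nn_integral_mono ennreal_powr_add_le) auto
  also have "\<dots> = ennreal (2 powr p) * ((\<integral>\<^sup>+x. ennreal (\<bar>v (x + h)\<bar> powr p) \<partial>lborel) + (\<integral>\<^sup>+x. ennreal (\<bar>v x\<bar> powr p) \<partial>lborel))"
    by (subst nn_integral_cmult, measurable, subst nn_integral_add) auto
  also have "(\<integral>\<^sup>+x. ennreal (\<bar>v (x + h)\<bar> powr p) \<partial>lborel) = (\<integral>\<^sup>+x. ennreal (\<bar>v x\<bar> powr p) \<partial>lborel)"
    by (rule nn_integral_translate) measurable
  finally show ?thesis by (simp add: mult_2)
qed

text \<open>The bound for \<open>\<phi> n\<close> passes to the limit because both errors, that of the functions and that of the
gradients, tend to \<open>0\<close> in \<open>L\<^sup>p\<close>. The factor \<open>8 powr p\<close> collects \<open>2 powr p\<close> from the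
bound for test functions and twice \<open>2 powr p\<close> from \<open>powr_add_le\<close>: once for replacing \<open>v\<close> by
\<open>\<phi> n\<close> and once for replacing \<open>grad (\<phi> n)\<close> by \<open>g\<close>.\<close>

lemma translation_bound_limit:
  fixes v :: "'a::euclidean_space \<Rightarrow> real" and g :: "'a \<Rightarrow> 'a"
  assumes p: "1 < p" and [measurable]: "v \<in> borel_measurable borel" "g \<in> borel_measurable borel"
    and \<phi>: "\<And>n. \<phi> n \<in> test_functions U"
    and lim: "(\<lambda>n. \<integral>\<^sup>+x. ennreal (\<bar>v x - \<phi> n x\<bar> powr p) \<partial>lborel) \<longlonglongrightarrow> 0"
      "(\<lambda>n. \<integral>\<^sup>+x. ennreal (norm (g x - grad (\<phi> n) x) powr p) \<partial>lborel) \<longlonglongrightarrow> 0"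
  shows "translation_bound p v (\<lambda>x. ennreal (8 powr p * norm (g x) powr p))"
  unfolding translation_bound_def
proof (intro allI ballI impI)
  fix h :: 'a and A B :: "'a set"
  assume [measurable]: "A \<in> sets borel" "B \<in> sets borel"
    and AB: "\<forall>x\<in>A. \<forall>t\<in>{0..1}. x + t *\<^sub>R h \<in> B"
  note [measurable] = test_function_measurable[OF \<phi>]
  let ?c = "ennreal (2 powr p)" and ?H = "ennreal (norm h powr p)"
  let ?N = "\<lambda>n. \<integral>\<^sup>+x. ennreal (\<bar>v x - \<phi> n x\<bar> powr p) \<partial>lborel"
  let ?M = "\<lambda>n. \<integral>\<^sup>+x. ennreal (norm (g x - grad (\<phi> n) x) powr p) \<partial>lborel"
  let ?L = "\<integral>\<^sup>+x. ennreal (\<bar>v (x + h) - v x\<bar> powr p) * indicator A x \<partial>lborel"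
  let ?G = "\<integral>\<^sup>+x. ennreal (norm (g x) powr p) * indicator B x \<partial>lborel"
  have "?L \<le> ?c * (?H * (?c * (?c * (?G + ?M n))) + ?c * (2 * ?N n))" for n
  proof -
    let ?d = "\<lambda>x. v x - \<phi> n x"
    have "(\<integral>\<^sup>+x. ennreal (2 powr p * norm (grad (\<phi> n) x) powr p) * indicator B x \<partial>lborel)
        \<le> (\<integral>\<^sup>+x. ?c * (?c * (ennreal (norm (g x) powr p) * indicator B x + ennreal (norm (g x - grad (\<phi> n) x) powr p))) \<partial>lborel)"
    proof (intro nn_integral_mono)
      fix x
      have "ennreal (norm (grad (\<phi> n) x) powr p)
         \<le> ?c * (ennreal (norm (g x) powr p) + ennreal (norm (g x - grad (\<phi> n) x) powr p))"
        using p norm_triangle_ineq4[of "g x" "g x - grad (\<phi> n) x"] by (intro ennreal_powr_add_le) auto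
      then show "ennreal (2 powr p * norm (grad (\<phi> n) x) powr p) * indicator B x
         \<le> ?c * (?c * (ennreal (norm (g x) powr p) * indicator B x + ennreal (norm (g x - grad (\<phi> n) x) powr p)))"
        by (auto split: split_indicator simp: ennreal_mult intro!: mult_left_mono)
    qed
    also have "\<dots> = ?c * (?c * (?G + ?M n))"
      by (subst nn_integral_cmult, measurable, subst nn_integral_cmult, measurable, subst nn_integral_add) auto
    finally have grad: "(\<integral>\<^sup>+x. ennreal (2 powr p * norm (grad (\<phi> n) x) powr p) * indicator B x \<partial>lborel)
        \<le> ?c * (?c * (?G + ?M n))" .
    have "?L \<le> (\<integral>\<^sup>+x. ?c * (ennreal (\<bar>\<phi> n (x + h) - \<phi> n x\<bar> powr p) * indicator A x
        + ennreal (\<bar>?d (x + h) - ?d x\<bar> powr p)) \<partial>lborel)"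
    proof (intro nn_integral_mono)
      fix x
      have "ennreal (\<bar>v (x + h) - v x\<bar> powr p)
         \<le> ?c * (ennreal (\<bar>\<phi> n (x + h) - \<phi> n x\<bar> powr p) + ennreal (\<bar>?d (x + h) - ?d x\<bar> powr p))"
        using p by (intro ennreal_powr_add_le) auto
      then show "ennreal (\<bar>v (x + h) - v x\<bar> powr p) * indicator A x
         \<le> ?c * (ennreal (\<bar>\<phi> n (x + h) - \<phi> n x\<bar> powr p) * indicator A x + ennreal (\<bar>?d (x + h) - ?d x\<bar> powr p))"
        by (auto split: split_indicator)
    qed
    also have "\<dots> = ?c * ((\<integral>\<^sup>+x. ennreal (\<bar>\<phi> n (x + h) - \<phi> n x\<bar> powr p) * indicator A x \<partial>lborel)
        + (\<integral>\<^sup>+x. ennreal (\<bar>?d (x + h) - ?d x\<bar> powr p) \<partial>lborel))"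
      by (subst nn_integral_cmult, measurable, subst nn_integral_add) auto
    also have "\<dots> \<le> ?c * (?H * (?c * (?c * (?G + ?M n))) + ?c * (2 * ?N n))"
    proof (intro mult_left_mono add_mono)
      have "(\<integral>\<^sup>+x. ennreal (\<bar>\<phi> n (x + h) - \<phi> n x\<bar> powr p) * indicator A x \<partial>lborel)
        \<le> ?H * (\<integral>\<^sup>+x. ennreal (2 powr p * norm (grad (\<phi> n) x) powr p) * indicator B x \<partial>lborel)"
        using test_function_translation_bound[OF \<phi> p] AB unfolding translation_bound_def by simp
      then show "(\<integral>\<^sup>+x. ennreal (\<bar>\<phi> n (x + h) - \<phi> n x\<bar> powr p) * indicator A x \<partial>lborel)
        \<le> ?H * (?c * (?c * (?G + ?M n)))"
        using grad by (rule order_trans[OF _ mult_left_mono]) auto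
      show "(\<integral>\<^sup>+x. ennreal (\<bar>?d (x + h) - ?d x\<bar> powr p) \<partial>lborel) \<le> ?c * (2 * ?N n)"
        by (rule nn_integral_translation_le[OF _ p]) measurable
    qed auto
    finally show ?thesis .
  qed
  moreover have "(\<lambda>n. ?c * (?H * (?c * (?c * (?G + ?M n))) + ?c * (2 * ?N n)))
      \<longlonglongrightarrow> ?c * (?H * (?c * (?c * (?G + 0))) + ?c * (2 * 0))"
    by (intro tendsto_add ennreal_tendsto_cmult tendsto_const lim) auto
  ultimately have "?L \<le> ?c * (?H * (?c * (?c * (?G + 0))) + ?c * (2 * 0))"
    by (intro LIMSEQ_le_const) auto
  also have "\<dots> = ?H * ((?c * (?c * ?c)) * ?G)"
    by (simp add: mult_ac)
  also have "?c * (?c * ?c) = ennreal (8 powr p)"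
    using powr_mult[of 2 4 p] powr_mult[of 2 2 p] by (simp add: ennreal_mult[symmetric])
  also have "ennreal (8 powr p) * ?G = (\<integral>\<^sup>+x. ennreal (8 powr p) * (ennreal (norm (g x) powr p) * indicator B x) \<partial>lborel)"
    by (rule nn_integral_cmult[symmetric]) measurable
  also have "\<dots> = (\<integral>\<^sup>+x. ennreal (8 powr p * norm (g x) powr p) * indicator B x \<partial>lborel)"
    by (simp add: ennreal_mult mult.assoc)
  finally show "?L \<le> ?H * (\<integral>\<^sup>+x. ennreal (8 powr p * norm (g x) powr p) * indicator B x \<partial>lborel)" .
qed

section \<open>The energy across the boundary\<close>

definition boundary_strip :: "'a::euclidean_space set \<Rightarrow> real \<Rightarrow> 'a set" where
  "boundary_strip \<Omega> r = (\<Union>w\<in>frontier \<Omega>. ball w r)"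

lemma boundary_strip_measurable [measurable]: "boundary_strip \<Omega> r \<in> sets borel"
  unfolding boundary_strip_def by (intro borel_open) auto

text \<open>The segment is connected and leaves \<open>\<Omega>\<close>, so it meets the boundary, at a point whose distance
from any other point of the segment is at most \<open>norm h\<close>.\<close>

lemma crossing_segment_in_strip:
  assumes "x \<in> \<Omega>" "x + h \<notin> \<Omega>" "t \<in> {0..1}" "norm h < r"
  shows "x + t *\<^sub>R h \<in> boundary_strip \<Omega> r"
proof -
  have "connected (closed_segment x (x + h))" by simp
  moreover have "x \<in> closed_segment x (x + h)" "x + h \<in> closed_segment x (x + h)" by auto
  ultimately obtain w where w: "w \<in> closed_segment x (x + h)" "w \<in> frontier \<Omega>"
    using connected_Int_frontier[of "closed_segment x (x + h)" \<Omega>] assms(1,2) by blast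
  then obtain s where s: "0 \<le> s" "s \<le> 1" "w = (1 - s) *\<^sub>R x + s *\<^sub>R (x + h)"
    by (auto simp: in_segment)
  have "dist w (x + t *\<^sub>R h) = norm ((s - t) *\<^sub>R h)"
    unfolding s(3) by (simp add: dist_norm algebra_simps)
  also have "\<dots> \<le> 1 * norm h"
    unfolding norm_scaleR using s assms(3) by (intro mult_right_mono) auto
  finally have "x + t *\<^sub>R h \<in> ball w r" using assms(4) by simp
  then show ?thesis using w(2) by (auto simp: boundary_strip_def)
qed

lemma nn_integral_reflect:
  fixes x :: "'a::euclidean_space"
  assumes [measurable]: "f \<in> borel_measurable borel"
  shows "(\<integral>\<^sup>+h. f (x - h) \<partial>lborel) = (\<integral>\<^sup>+y. f y \<partial>lborel)"
proof -
  have "(\<integral>\<^sup>+y. f y \<partial>lborel) = (\<integral>\<^sup>+y. f y \<partial>(distr lborel borel (\<lambda>h. x + (- 1) *\<^sub>R h)))"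
    by (subst lborel_affine[of "- 1" x]) (simp_all add: density_1)
  also have "\<dots> = (\<integral>\<^sup>+h. f (x - h) \<partial>lborel)"
    by (subst nn_integral_distr) auto
  finally show ?thesis by simp
qed

text \<open>After the substitution \<open>y = x - h\<close> the jumps are split according to their length. Since
\<open>\<delta> \<le> 1\<close>, the factor \<open>norm h powr p\<close> gained for a short jump is the weight in the
normalization of the kernel.\<close>

lemma crossing_energy_le:
  fixes v k :: "'a::euclidean_space \<Rightarrow> real"
  assumes p: "1 < p" and \<Omega>: "open \<Omega>" and \<delta>: "0 < \<delta>" "\<delta> \<le> 1"
    and [measurable]: "v \<in> borel_measurable borel" "k \<in> borel_measurable borel" "G \<in> borel_measurable borel"
    and k: "\<And>h. 0 \<le> k h"
    and bound: "translation_bound p v G"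
  shows "(\<integral>\<^sup>+(x, y). ennreal (\<bar>v x - v y\<bar> powr p * k (x - y)) * indicator (\<Omega> \<times> - \<Omega>) (x, y) \<partial>lborel)
    \<le> (\<integral>\<^sup>+x. G x * indicator (boundary_strip \<Omega> (2 * \<delta>)) x \<partial>lborel) * (\<integral>\<^sup>+h. ennreal (min 1 (norm h powr p) * k h) \<partial>lborel)
      + ennreal (2 powr p) * (2 * (\<integral>\<^sup>+x. ennreal (\<bar>v x\<bar> powr p) \<partial>lborel)) * (\<integral>\<^sup>+h. ennreal (k h) * indicator {h. \<delta> < norm h} h \<partial>lborel)"
    (is "?E \<le> ?S * ?K + ?V * ?T")
proof -
  have [measurable]: "\<Omega> \<in> sets borel" using \<Omega> by simp
  let ?F = "\<lambda>x y. ennreal (\<bar>v x - v y\<bar> powr p * k (x - y)) * indicator (\<Omega> \<times> - \<Omega>) (x, y)"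
  let ?D = "\<lambda>h. {x. x \<in> \<Omega> \<and> x - h \<notin> \<Omega>}"
  have "?E = (\<integral>\<^sup>+z. (\<lambda>(x, y). ?F x y) z \<partial>(lborel \<Otimes>\<^sub>M lborel))"
    by (simp add: lborel_prod)
  also have "\<dots> = (\<integral>\<^sup>+x. (\<integral>\<^sup>+y. ?F x y \<partial>lborel) \<partial>lborel)"
    by (subst lborel.nn_integral_fst[symmetric]) (auto simp: indicator_times)
  also have "\<dots> = (\<integral>\<^sup>+x. (\<integral>\<^sup>+h. ?F x (x - h) \<partial>lborel) \<partial>lborel)"
    by (intro nn_integral_cong nn_integral_reflect[symmetric]) (auto simp: indicator_times)
  also have "\<dots> = (\<integral>\<^sup>+h. (\<integral>\<^sup>+x. ?F x (x - h) \<partial>lborel) \<partial>lborel)"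
    by (rule lborel_pair.Fubini'[symmetric]) (simp add: indicator_times)
  also have "\<dots> \<le> (\<integral>\<^sup>+h. ?S * ennreal (min 1 (norm h powr p) * k h) + ?V * (ennreal (k h) * indicator {h. \<delta> < norm h} h) \<partial>lborel)"
  proof (intro nn_integral_mono)
    fix h :: 'a
    let ?I = "\<integral>\<^sup>+x. ennreal (\<bar>v (x + - h) - v x\<bar> powr p) * indicator (?D h) x \<partial>lborel"
    have "(\<integral>\<^sup>+x. ?F x (x - h) \<partial>lborel) = (\<integral>\<^sup>+x. ennreal (k h) * (ennreal (\<bar>v (x + - h) - v x\<bar> powr p) * indicator (?D h) x) \<partial>lborel)"
      using k by (intro nn_integral_cong) (auto simp: ennreal_mult mult_ac abs_minus_commute split: split_indicator)
    also have "\<dots> = ennreal (k h) * ?I"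
      by (rule nn_integral_cmult) measurable
    also have "\<dots> \<le> ?S * ennreal (min 1 (norm h powr p) * k h) + ?V * (ennreal (k h) * indicator {h. \<delta> < norm h} h)"
    proof (cases "\<delta> < norm h")
      case True
      have "?I \<le> (\<integral>\<^sup>+x. ennreal (\<bar>v (x + - h) - v x\<bar> powr p) \<partial>lborel)"
        by (intro nn_integral_mono) (auto split: split_indicator)
      also have "\<dots> \<le> ?V"
        by (rule nn_integral_translation_le[OF _ p]) measurable
      finally have "ennreal (k h) * ?I \<le> ?V * ennreal (k h)"
        by (subst mult.commute) (rule mult_right_mono, auto)
      then show ?thesis using True by (simp add: add_increasing)
    next
      case False
      have "?I \<le> ennreal (norm (- h) powr p) * ?S"
        using bound[unfolded translation_bound_def, rule_format, of "?D h" "boundary_strip \<Omega> (2 * \<delta>)" "- h"]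
          crossing_segment_in_strip[of _ \<Omega> "- h" _ "2 * \<delta>"] False \<delta> by auto
      moreover have "norm h powr p = min 1 (norm h powr p)"
        using False \<delta> p powr_mono2[of p "norm h" 1] by auto
      ultimately have "ennreal (k h) * ?I \<le> ennreal (k h) * (ennreal (min 1 (norm h powr p)) * ?S)"
        by (intro mult_left_mono) auto
      also have "\<dots> = ?S * ennreal (min 1 (norm h powr p) * k h)"
        using k by (simp add: ennreal_mult mult_ac)
      finally show ?thesis by (simp add: add_increasing2)
    qed
    finally show "(\<integral>\<^sup>+x. ?F x (x - h) \<partial>lborel) \<le> ?S * ennreal (min 1 (norm h powr p) * k h) + ?V * (ennreal (k h) * indicator {h. \<delta> < norm h} h)" .
  qed
  also have "\<dots> = ?S * ?K + ?V * ?T"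
    by (subst nn_integral_add, measurable, subst (1 2) nn_integral_cmult) auto
  finally show ?thesis .
qed

text \<open>The strips decrease to the boundary, which is closed, so the claim is continuity from above of the finite
measure with density \<open>G\<close>.\<close>

lemma boundary_strip_integral_small:
  fixes G :: "'a::euclidean_space \<Rightarrow> ennreal"
  assumes [measurable]: "G \<in> borel_measurable borel"
    and fin: "(\<integral>\<^sup>+x. G x \<partial>lborel) < \<infinity>"
    and frontier: "(\<integral>\<^sup>+x. G x * indicator (frontier \<Omega>) x \<partial>lborel) = 0"
    and e: "0 < e"
  obtains \<delta> where "0 < \<delta>" "\<delta> \<le> 1" "(\<integral>\<^sup>+x. G x * indicator (boundary_strip \<Omega> (2 * \<delta>)) x \<partial>lborel) < e"
proof -
  let ?\<mu> = "density lborel G"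
  let ?B = "\<lambda>n. boundary_strip \<Omega> (2 * inverse (real (Suc n)))"
  have \<mu>: "emeasure ?\<mu> A = (\<integral>\<^sup>+x. G x * indicator A x \<partial>lborel)" if "A \<in> sets borel" for A
    using that by (simp add: emeasure_density)
  have Inter: "(\<Inter>n. ?B n) = frontier \<Omega>"
  proof (intro equalityI subsetI)
    fix x assume "x \<in> frontier \<Omega>"
    then show "x \<in> (\<Inter>n. ?B n)" by (auto simp: boundary_strip_def intro!: bexI[of _ x])
  next
    fix x assume x: "x \<in> (\<Inter>n. ?B n)"
    have "\<exists>w\<in>frontier \<Omega>. dist w x < r" if r: "r > 0" for r
    proof -
      obtain n where n: "inverse (real (Suc n)) < r / 2" using reals_Archimedean[OF half_gt_zero[OF r]] by blast
      obtain w where "w \<in> frontier \<Omega>" "dist w x < 2 * inverse (real (Suc n))"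
        using x by (auto simp: boundary_strip_def)
      then show ?thesis using n by (intro bexI[of _ w]) auto
    qed
    then have "x \<in> closure (frontier \<Omega>)" unfolding closure_approachable by blast
    then show "x \<in> frontier \<Omega>" by (simp only: closure_closed[OF frontier_closed])
  qed
  have "(\<lambda>n. emeasure ?\<mu> (?B n)) \<longlonglongrightarrow> emeasure ?\<mu> (\<Inter>n. ?B n)"
  proof (rule Lim_emeasure_decseq)
    show "decseq ?B"
    proof (rule decseq_SucI)
      fix n
      have "inverse (real (Suc (Suc n))) \<le> inverse (real (Suc n))" by (simp add: field_simps)
      then show "?B (Suc n) \<subseteq> ?B n"
        unfolding boundary_strip_def by (intro UN_mono subset_ball) auto
    qed
    show "emeasure ?\<mu> (?B n) \<noteq> \<infinity>" for n
    proof -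
      have "emeasure ?\<mu> (?B n) \<le> (\<integral>\<^sup>+x. G x \<partial>lborel)"
        by (subst \<mu>) (auto intro!: nn_integral_mono split: split_indicator)
      then show ?thesis using fin by auto
    qed
  qed auto
  then have "(\<lambda>n. emeasure ?\<mu> (?B n)) \<longlonglongrightarrow> 0"
    unfolding Inter using frontier by (simp add: \<mu> frontier_closed)
  then have "\<forall>\<^sub>F n in sequentially. emeasure ?\<mu> (?B n) < e"
    using e by (rule order_tendstoD)
  then obtain n where n: "emeasure ?\<mu> (?B n) < e"
    using eventually_happens'[OF sequentially_bot] by blast
  show thesis
  proof (rule that)
    show "0 < inverse (real (Suc n))" "inverse (real (Suc n)) \<le> 1"
      by (simp_all add: inverse_le_1_iff)
    show "(\<integral>\<^sup>+x. G x * indicator (?B n) x \<partial>lborel) < e"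
      using n unfolding \<mu>[OF boundary_strip_measurable] .
  qed
qed

section \<open>Lebesgue measurability and Borel representatives\<close>

text \<open>A Borel map is Lebesgue measurable as soon as preimages of null sets are null sets; by Fubini this may be
checked on the sections in the second variable. The coordinate maps and the difference of the coordinates,
through which the integrands of the forms are built, have this property.\<close>

lemma lebesgue_measurable_if_null_preimages:
  fixes T :: "'a::euclidean_space \<times> 'a \<Rightarrow> 'a"
  assumes [measurable]: "T \<in> borel_measurable borel"
    and null: "\<And>N. N \<in> null_sets lborel \<Longrightarrow> AE x in lborel. AE y in lborel. T (x, y) \<notin> N"
  shows "T \<in> lebesgue \<rightarrow>\<^sub>M lebesgue"
    and "(AE x in lborel. P x) \<Longrightarrow> AE z in lborel. P (T z)"
proof -
  have N: "AE z in lborel. T z \<notin> N" if N: "N \<in> null_sets lborel" for N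
  proof -
    have [measurable]: "N \<in> sets borel" using N by auto
    have "{z. T z \<notin> N} \<in> sets borel" by measurable
    then have "{z \<in> space (lborel \<Otimes>\<^sub>M lborel). T z \<notin> N} \<in> sets (lborel \<Otimes>\<^sub>M lborel)"
      unfolding lborel_prod by simp
    then have "AE z in lborel \<Otimes>\<^sub>M lborel. T z \<notin> N"
      by (rule lborel_pair.AE_pair_measure[OF _ null[OF N]])
    then show ?thesis unfolding lborel_prod .
  qed
  show "T \<in> lebesgue \<rightarrow>\<^sub>M lebesgue"
  proof (rule completion.measurable_completion2)
    show T: "T \<in> lebesgue \<rightarrow>\<^sub>M lborel" by (rule measurable_completion) simp
    show "null_sets lborel \<subseteq> null_sets (distr lebesgue lborel T)"
    proof
      fix N :: "'a set" assume "N \<in> null_sets lborel"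
      then have "N \<in> sets lborel" "AE z in lebesgue. z \<notin> T -` N \<inter> space lebesgue"
        using AE_completion[OF N] by auto
      then show "N \<in> null_sets (distr lebesgue lborel T)"
        using T measurable_sets[OF T, of N] by (simp add: AE_iff_null_sets AE_distr_iff)
    qed
  qed
  assume "AE x in lborel. P x"
  then obtain N' where "N' \<in> null_sets lborel" "{x \<in> space lborel. \<not> P x} \<subseteq> N'"
    by (auto elim: AE_E3 simp: eventually_ae_filter)
  with N[OF this(1)] show "AE z in lborel. P (T z)"
    by (auto elim!: eventually_mono)
qed

lemma null_preimages:
  fixes N :: "'a::euclidean_space set"
  assumes "N \<in> null_sets lborel"
  shows "AE x in lborel. AE y in lborel. fst (x, y :: 'a) \<notin> N"
    and "AE x in lborel. AE y in lborel. snd (x :: 'a, y) \<notin> N"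
    and "AE x in lborel. AE y in lborel. fst (x, y) - snd (x, y) \<notin> N"
proof -
  have [measurable]: "N \<in> sets borel" using assms by auto
  have "AE x in lborel. x \<notin> N" using assms by (rule AE_not_in)
  then show "AE x in lborel. AE y in lborel. fst (x, y :: 'a) \<notin> N"
    by eventually_elim simp
  show "AE x in lborel. AE y in lborel. snd (x :: 'a, y) \<notin> N"
    using \<open>AE x in lborel. x \<notin> N\<close> by simp
  have "AE y in lborel. x - y \<notin> N" for x
  proof -
    have "(\<integral>\<^sup>+y. indicator N (x - y) \<partial>lborel) = (\<integral>\<^sup>+y. indicator N y \<partial>lborel)"
      by (rule nn_integral_reflect) measurable
    also have "\<dots> = 0" using assms by auto
    finally have "AE y in lborel. indicator N (x - y) = (0 :: ennreal)"
      by (subst (asm) nn_integral_0_iff_AE) auto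
    then show ?thesis by eventually_elim (auto simp: indicator_def split: if_splits)
  qed
  then show "AE x in lborel. AE y in lborel. fst (x, y) - snd (x, y) \<notin> N" by simp
qed

lemma
  shows lebesgue_measurable_fst: "(fst :: 'a::euclidean_space \<times> 'a \<Rightarrow> 'a) \<in> lebesgue \<rightarrow>\<^sub>M lebesgue"
    and lebesgue_measurable_snd: "(snd :: 'a \<times> 'a \<Rightarrow> 'a) \<in> lebesgue \<rightarrow>\<^sub>M lebesgue"
    and lebesgue_measurable_diff: "(\<lambda>z :: 'a \<times> 'a. fst z - snd z) \<in> lebesgue \<rightarrow>\<^sub>M lebesgue"
  by (rule lebesgue_measurable_if_null_preimages(1)[OF _ null_preimages(1)]
           lebesgue_measurable_if_null_preimages(1)[OF _ null_preimages(2)]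
           lebesgue_measurable_if_null_preimages(1)[OF _ null_preimages(3)];
      simp add: borel_prod[symmetric])+

lemma
  fixes P :: "'a::euclidean_space \<Rightarrow> bool"
  assumes "AE x in lborel. P x"
  shows AE_fst: "AE z in lborel. P (fst (z :: 'a \<times> 'a))"
    and AE_snd: "AE z in lborel. P (snd (z :: 'a \<times> 'a))"
    and AE_diff: "AE z in lborel. P (fst z - snd (z :: 'a \<times> 'a))"
  by (rule lebesgue_measurable_if_null_preimages(2)[OF _ null_preimages(1) assms]
           lebesgue_measurable_if_null_preimages(2)[OF _ null_preimages(2) assms]
           lebesgue_measurable_if_null_preimages(2)[OF _ null_preimages(3) assms];
      simp add: borel_prod[symmetric])+

lemma measurable_zero_extension:
  fixes f :: "'a::euclidean_space \<Rightarrow> 'b::euclidean_space"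
  assumes "f \<in> borel_measurable (lebesgue_on S)" "S \<in> sets lebesgue"
  shows "(\<lambda>x. indicator S x *\<^sub>R f x) \<in> borel_measurable lebesgue"
  using assms by (subst borel_measurable_restrict_space_iff[symmetric]) auto

text \<open>The integrand vanishes on the diagonal, so the kernel may be replaced by its extension by zero, which is
measurable on the whole space.\<close>

lemma form_integrand_measurable:
  fixes u v :: "'a::euclidean_space \<Rightarrow> real"
  assumes u: "u \<in> borel_measurable lebesgue" and v: "v \<in> borel_measurable lebesgue"
    and \<nu>: "\<nu> \<in> borel_measurable (lebesgue_on (- {0}))"
  shows "form_integrand p \<nu> u v \<in> borel_measurable lebesgue"
proof -
  let ?k = "\<lambda>h. indicator (- {0}) h *\<^sub>R \<nu> h"
  have k: "?k \<in> borel_measurable lebesgue"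
    by (rule measurable_zero_extension[OF \<nu>]) simp
  note [measurable] = measurable_compose[OF lebesgue_measurable_fst u] measurable_compose[OF lebesgue_measurable_snd u]
    measurable_compose[OF lebesgue_measurable_fst v] measurable_compose[OF lebesgue_measurable_snd v]
    measurable_compose[OF lebesgue_measurable_diff k]
  have "form_integrand p \<nu> u v = (\<lambda>z. \<bar>u (fst z) - u (snd z)\<bar> powr (p - 2) * (u (fst z) - u (snd z))
      * (v (fst z) - v (snd z)) * (\<lambda>z. ?k (fst z - snd z)) z)"
    by (auto simp: form_integrand_def fun_eq_iff indicator_def)
  also have "\<dots> \<in> borel_measurable lebesgue" by measurable
  finally show ?thesis .
qed

text \<open>Fubini and the substitutions above are applied to Borel functions, whereas Sobolev functions and kernels
are only Lebesgue measurable.\<close>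

lemma borel_representative:
  fixes f :: "'a::euclidean_space \<Rightarrow> 'b::euclidean_space"
  assumes "f \<in> borel_measurable lebesgue"
  obtains f' where "f' \<in> borel_measurable borel" "AE x in lborel. f x = f' x"
proof -
  have "\<forall>b. \<exists>f'. f' \<in> borel_measurable borel \<and> (AE x in lborel. f x \<bullet> b = f' x)"
  proof
    fix b
    have "\<exists>f'\<in>borel_measurable lborel. AE x in lborel. f x \<bullet> b = f' x"
      by (rule completion_ex_borel_measurable_real) (use assms in measurable)
    then show "\<exists>f'. f' \<in> borel_measurable borel \<and> (AE x in lborel. f x \<bullet> b = f' x)" by auto
  qed
  from choice[OF this] obtain f' where f': "\<And>b. f' b \<in> borel_measurable borel" "\<And>b. AE x in lborel. f x \<bullet> b = f' b x"
    by blast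
  have "AE x in lborel. \<forall>b\<in>Basis. f x \<bullet> b = f' b x"
    using f'(2) by (intro AE_finite_allI) auto
  then have "AE x in lborel. f x = (\<Sum>b\<in>Basis. f' b x *\<^sub>R b)"
    by eventually_elim (metis (no_types, lifting) euclidean_representation sum.cong)
  moreover have "(\<lambda>x. \<Sum>b\<in>Basis. f' b x *\<^sub>R b) \<in> borel_measurable borel"
    using f'(1) by measurable
  ultimately show thesis using that by blast
qed

lemma lebesgue_lborel_cong:
  fixes f f' :: "'a::euclidean_space \<Rightarrow> real"
  assumes f: "f \<in> borel_measurable lebesgue" and f': "f' \<in> borel_measurable borel"
    and eq: "AE x in lborel. f x = f' x"
  shows "(LINT x|lebesgue. f x) = (LINT x|lborel. f' x)"
    and "integrable lebesgue f \<longleftrightarrow> integrable lborel f'"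
proof -
  have m: "f' \<in> borel_measurable lebesgue" using f' by (intro measurable_completion) simp
  have eq': "AE x in lebesgue. f x = f' x" by (rule AE_completion[OF eq])
  show "(LINT x|lebesgue. f x) = (LINT x|lborel. f' x)"
    using integral_cong_AE[OF f m eq'] integral_completion[of f' lborel] f' by simp
  show "integrable lebesgue f \<longleftrightarrow> integrable lborel f'"
    using integrable_cong_AE[OF f m eq'] integrable_completion[of f' lborel] f' by simp
qed

text \<open>The normalization is a statement about a Bochner integral, which would be \<open>0\<close> if the integrand were
not integrable. Its value \<open>1\<close> therefore gives integrability, and by comparison also that of the kernel
outside every ball around the origin.\<close>

lemma kernel_borel_representative:
  fixes \<nu> :: "real \<Rightarrow> 'a::euclidean_space \<Rightarrow> real"
  assumes ker: "kernel_family p \<nu>" and \<epsilon>: "0 < \<epsilon>" and p: "1 < p"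
  obtains k where "k \<in> borel_measurable borel" "\<And>h. 0 \<le> k h"
    "AE h in lborel. h \<noteq> 0 \<longrightarrow> \<nu> \<epsilon> h = k h"
    "(\<integral>\<^sup>+h. ennreal (min 1 (norm h powr p) * k h) \<partial>lborel) = 1"
    "\<And>\<delta>. 0 < \<delta> \<Longrightarrow> (\<integral>\<^sup>+h. ennreal (k h) * indicator {h. \<delta> < norm h} h \<partial>lborel)
        = ennreal (LINT h:{h. \<delta> < norm h}|lebesgue. \<nu> \<epsilon> h)"
proof -
  let ?k = "\<lambda>h. indicator (- {0}) h *\<^sub>R \<nu> \<epsilon> h"
  have meas: "\<nu> \<epsilon> \<in> borel_measurable (lebesgue_on (- {0}))" and nonneg: "\<And>h. h \<noteq> 0 \<Longrightarrow> 0 \<le> \<nu> \<epsilon> h"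
    and norm1: "(LINT h|lebesgue. min 1 (norm h powr p) * \<nu> \<epsilon> h) = 1"
    using ker \<epsilon> unfolding kernel_family_def by blast+
  have km: "?k \<in> borel_measurable lebesgue"
    by (rule measurable_zero_extension[OF meas]) simp
  obtain k1 where k1 [measurable]: "k1 \<in> borel_measurable borel" and k1eq: "AE h in lborel. ?k h = k1 h"
    using borel_representative[OF km] by metis
  define k where "k h = max 0 (k1 h)" for h
  have k [measurable]: "k \<in> borel_measurable borel" unfolding k_def by measurable
  have k0: "0 \<le> k h" for h by (simp add: k_def)
  have keq: "AE h in lborel. ?k h = k h"
    using k1eq
  proof eventually_elim
    case (elim h)
    then show ?case using nonneg[of h] by (cases "h = 0") (auto simp: k_def)
  qed
  have id: "(\<lambda>h::'a. min 1 (norm h powr p)) \<in> borel_measurable lebesgue"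
    by (rule measurable_completion) simp
  have "(LINT h|lebesgue. min 1 (norm h powr p) * \<nu> \<epsilon> h) = (LINT h|lebesgue. min 1 (norm h powr p) * ?k h)"
    using p by (intro Bochner_Integration.integral_cong) (auto simp: indicator_def)
  also have "\<dots> = (LINT h|lborel. min 1 (norm h powr p) * k h)"
    by (rule lebesgue_lborel_cong(1)) (use id km keq in \<open>auto intro: borel_measurable_times\<close>)
  finally have one: "(LINT h|lborel. min 1 (norm h powr p) * k h) = 1" using norm1 by simp
  then have int: "integrable lborel (\<lambda>h. min 1 (norm h powr p) * k h)"
    by (metis not_integrable_integral_eq zero_neq_one)
  show thesis
  proof (rule that[of k])
    show "(\<integral>\<^sup>+h. ennreal (min 1 (norm h powr p) * k h) \<partial>lborel) = 1"
      using nn_integral_eq_integral[OF int] one k0 by simp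
    show "AE h in lborel. h \<noteq> 0 \<longrightarrow> \<nu> \<epsilon> h = k h"
      using keq by eventually_elim auto
    fix \<delta> :: real assume \<delta>: "0 < \<delta>"
    let ?A = "{h :: 'a. \<delta> < norm h}"
    have [measurable]: "?A \<in> sets borel" by measurable
    have A: "(indicator ?A :: 'a \<Rightarrow> real) \<in> borel_measurable lebesgue"
      by (rule measurable_completion) simp
    have "(LINT h:?A|lebesgue. \<nu> \<epsilon> h) = (LINT h|lebesgue. indicator ?A h * ?k h)"
      unfolding set_lebesgue_integral_def using \<delta>
      by (intro Bochner_Integration.integral_cong) (auto simp: indicator_def)
    also have "\<dots> = (LINT h|lborel. indicator ?A h * k h)"
      by (rule lebesgue_lborel_cong(1)) (use A km keq in \<open>auto intro: borel_measurable_times\<close>)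
    finally have eq: "(LINT h:?A|lebesgue. \<nu> \<epsilon> h) = (LINT h|lborel. indicator ?A h * k h)" .
    have c: "0 < min 1 (\<delta> powr p)" using \<delta> by simp
    have "integrable lborel (\<lambda>h. indicator ?A h * k h)"
    proof (rule Bochner_Integration.integrable_bound)
      show "integrable lborel (\<lambda>h. inverse (min 1 (\<delta> powr p)) * (min 1 (norm h powr p) * k h))"
        using int by simp
      show "AE h in lborel. norm (indicator ?A h * k h) \<le> norm (inverse (min 1 (\<delta> powr p)) * (min 1 (norm h powr p) * k h))"
      proof (rule AE_I2)
        fix h :: 'a
        have "k h \<le> inverse (min 1 (\<delta> powr p)) * (min 1 (norm h powr p) * k h)" if h: "\<delta> < norm h"
        proof -
          have "min 1 (\<delta> powr p) \<le> min 1 (norm h powr p)"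
            using powr_mono2[of p \<delta> "norm h"] p h \<delta> by auto
          then have "1 \<le> inverse (min 1 (\<delta> powr p)) * min 1 (norm h powr p)"
            using c by (simp add: field_simps)
          from mult_right_mono[OF this k0] show ?thesis by (simp add: mult.assoc)
        qed
        then show "norm (indicator ?A h * k h) \<le> norm (inverse (min 1 (\<delta> powr p)) * (min 1 (norm h powr p) * k h))"
          using k0[of h] by (auto split: split_indicator)
      qed
    qed measurable
    then have "(\<integral>\<^sup>+h. ennreal (indicator ?A h * k h) \<partial>lborel) = ennreal (LINT h|lborel. indicator ?A h * k h)"
      using k0 by (intro nn_integral_eq_integral) auto
    then show "(\<integral>\<^sup>+h. ennreal (k h) * indicator ?A h \<partial>lborel) = ennreal (LINT h:?A|lebesgue. \<nu> \<epsilon> h)"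
      unfolding eq by (subst nn_integral_cong[where v="\<lambda>h. ennreal (indicator ?A h * k h)"]) (auto split: split_indicator)
  qed (use k0 in auto)
qed

lemma form_integrand_diag:
  "form_integrand p \<nu> v v (x, y) = \<bar>v x - v y\<bar> powr p * \<nu> (x - y)"
proof (cases "v x = v y")
  case False
  then have "\<bar>v x - v y\<bar> powr p = \<bar>v x - v y\<bar> powr (p - 2) * \<bar>v x - v y\<bar> powr 2"
    using powr_add[of "\<bar>v x - v y\<bar>" "p - 2" 2] by simp
  then show ?thesis
    using False by (simp add: form_integrand_def powr_numeral power2_eq_square abs_mult[symmetric] mult.assoc)
qed (simp add: form_integrand_def)

text \<open>For given \<open>e\<close>, first \<open>\<delta>\<close> is chosen to make the strip term of \<open>crossing_energy_le\<close> small,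
and then \<open>\<epsilon>\<close> to make the mass of the kernel outside the ball of radius \<open>\<delta>\<close> small.
Finiteness for a fixed \<open>\<epsilon>\<close> is the same estimate with \<open>\<delta> = 1\<close>.\<close>

section \<open>Vanishing of the energy of a function with a translation bound\<close>

lemma self_crossing_energy_tendsto_0:
  fixes v v' :: "'a::euclidean_space \<Rightarrow> real"
  assumes p: "1 < p" and ker: "kernel_family p \<nu>" and \<Omega>: "open \<Omega>"
    and v: "v \<in> borel_measurable lebesgue"
    and v' [measurable]: "v' \<in> borel_measurable borel" and vv': "AE x in lborel. v x = v' x"
    and vfin: "(\<integral>\<^sup>+x. ennreal (\<bar>v' x\<bar> powr p) \<partial>lborel) < \<infinity>"
    and G [measurable]: "G \<in> borel_measurable borel" and Gfin: "(\<integral>\<^sup>+x. G x \<partial>lborel) < \<infinity>"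
    and Gfr: "(\<integral>\<^sup>+x. G x * indicator (frontier \<Omega>) x \<partial>lborel) = 0"
    and bound: "translation_bound p v' G"
  shows "\<And>\<epsilon>. 0 < \<epsilon> \<Longrightarrow> set_integrable lebesgue (\<Omega> \<times> - \<Omega>) (form_integrand p (\<nu> \<epsilon>) v v)"
    and "((\<lambda>\<epsilon>. form_cr p \<Omega> (\<nu> \<epsilon>) v v) \<longlongrightarrow> 0) (at_right 0)"
proof -
  have [measurable]: "\<Omega> \<in> sets borel" using \<Omega> by simp
  have prod [measurable]: "\<Omega> \<times> - \<Omega> \<in> sets borel"
    by (simp add: borel_prod[symmetric])
  let ?V = "ennreal (2 powr p) * (2 * (\<integral>\<^sup>+x. ennreal (\<bar>v' x\<bar> powr p) \<partial>lborel))"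
  let ?S = "\<lambda>\<delta>. \<integral>\<^sup>+x. G x * indicator (boundary_strip \<Omega> (2 * \<delta>)) x \<partial>lborel"
  let ?T = "\<lambda>\<delta> \<epsilon>. LINT h:{h. \<delta> < norm h}|lebesgue. \<nu> \<epsilon> h"
  let ?f = "\<lambda>\<epsilon> z. indicator (\<Omega> \<times> - \<Omega>) z *\<^sub>R form_integrand p (\<nu> \<epsilon>) v v z"
  have V: "?V < \<infinity>" using vfin by (simp add: ennreal_mult_less_top)
  have nonneg: "0 \<le> ?f \<epsilon> z" if "0 < \<epsilon>" for \<epsilon> z
  proof -
    have *: "0 \<le> \<nu> \<epsilon> h" if "h \<noteq> 0" for h
      using ker \<open>0 < \<epsilon>\<close> that unfolding kernel_family_def by blast
    obtain x y where z: "z = (x, y)" by (cases z)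
    have "0 \<le> \<nu> \<epsilon> (x - y)" if "x \<in> \<Omega>" "y \<notin> \<Omega>"
      using that by (intro *) auto
    then show ?thesis
      by (auto simp: z form_integrand_diag split: split_indicator)
  qed
  have meas: "?f \<epsilon> \<in> borel_measurable lebesgue" if \<epsilon>: "0 < \<epsilon>" for \<epsilon>
  proof -
    have "\<nu> \<epsilon> \<in> borel_measurable (lebesgue_on (- {0}))"
      using ker \<epsilon> unfolding kernel_family_def by blast
    then have "form_integrand p (\<nu> \<epsilon>) v v \<in> borel_measurable lebesgue"
      by (rule form_integrand_measurable[OF v v])
    moreover have "(indicator (\<Omega> \<times> - \<Omega>) :: _ \<Rightarrow> real) \<in> borel_measurable lebesgue"
      by (rule measurable_completion) simp
    ultimately show ?thesis by (intro borel_measurable_scaleR)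
  qed
  have le: "(\<integral>\<^sup>+z. ennreal (?f \<epsilon> z) \<partial>lebesgue) \<le> ?S \<delta> + ?V * ennreal (?T \<delta> \<epsilon>)"
    if \<epsilon>: "0 < \<epsilon>" and \<delta>: "0 < \<delta>" "\<delta> \<le> 1" for \<epsilon> \<delta>
  proof -
    obtain k where km [measurable]: "k \<in> borel_measurable borel" and k: "\<And>h. 0 \<le> k h"
      "AE h in lborel. h \<noteq> 0 \<longrightarrow> \<nu> \<epsilon> h = k h"
      "(\<integral>\<^sup>+h. ennreal (min 1 (norm h powr p) * k h) \<partial>lborel) = 1"
      "\<And>\<delta>. 0 < \<delta> \<Longrightarrow> (\<integral>\<^sup>+h. ennreal (k h) * indicator {h. \<delta> < norm h} h \<partial>lborel) = ennreal (?T \<delta> \<epsilon>)"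
      by (rule kernel_borel_representative[OF ker \<epsilon> p]) (rule that)
    have "(\<integral>\<^sup>+z. ennreal (?f \<epsilon> z) \<partial>lebesgue) = (\<integral>\<^sup>+z. ennreal (?f \<epsilon> z) \<partial>lborel)"
      by (rule nn_integral_completion)
    also have "\<dots> = (\<integral>\<^sup>+(x, y). ennreal (\<bar>v' x - v' y\<bar> powr p * k (x - y)) * indicator (\<Omega> \<times> - \<Omega>) (x, y) \<partial>lborel)"
    proof (rule nn_integral_cong_AE)
      show "AE z in lborel. ennreal (?f \<epsilon> z)
         = (case z of (x, y) \<Rightarrow> ennreal (\<bar>v' x - v' y\<bar> powr p * k (x - y)) * indicator (\<Omega> \<times> - \<Omega>) (x, y))"
        using AE_fst[OF vv'] AE_snd[OF vv'] AE_diff[OF k(2)]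
      proof eventually_elim
        case (elim z)
        then show ?case
          by (cases z) (auto simp: form_integrand_diag indicator_def)
      qed
    qed
    also have "\<dots> \<le> ?S \<delta> * 1 + ?V * ennreal (?T \<delta> \<epsilon>)"
      using crossing_energy_le[OF p \<Omega> \<delta> v' km G k(1) bound] k(3) k(4)[OF \<delta>(1)] by simp
    finally show ?thesis by simp
  qed
  show int: "set_integrable lebesgue (\<Omega> \<times> - \<Omega>) (form_integrand p (\<nu> \<epsilon>) v v)" if \<epsilon>: "0 < \<epsilon>" for \<epsilon>
  proof -
    have "?S 1 \<le> (\<integral>\<^sup>+x. G x \<partial>lborel)"
      by (intro nn_integral_mono) (auto split: split_indicator)
    then have "?S 1 + ?V * ennreal (?T 1 \<epsilon>) < \<infinity>"
      using Gfin V by (auto simp: ennreal_mult_less_top)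
    then have "(\<integral>\<^sup>+z. ennreal (?f \<epsilon> z) \<partial>lebesgue) < \<infinity>"
      by (rule le_less_trans[OF le[OF \<epsilon> zero_less_one order_refl]])
    then show ?thesis
      unfolding set_integrable_def using nonneg[OF \<epsilon>] meas[OF \<epsilon>]
      by (intro integrableI_bounded) auto
  qed
  have J: "ennreal (form_cr p \<Omega> (\<nu> \<epsilon>) v v) = (\<integral>\<^sup>+z. ennreal (?f \<epsilon> z) \<partial>lebesgue)" if "0 < \<epsilon>" for \<epsilon>
    unfolding form_cr_def set_lebesgue_integral_def
    using int[OF that] nonneg[OF that] by (subst nn_integral_eq_integral) (auto simp: set_integrable_def)
  show "((\<lambda>\<epsilon>. form_cr p \<Omega> (\<nu> \<epsilon>) v v) \<longlongrightarrow> 0) (at_right 0)"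
  proof (rule tendstoI)
    fix e :: real assume e: "0 < e"
    obtain \<delta> where \<delta>: "0 < \<delta>" "\<delta> \<le> 1" "?S \<delta> < ennreal (e / 2)"
      using boundary_strip_integral_small[OF G Gfin Gfr, of "ennreal (e / 2)"] e by auto
    have "((\<lambda>\<epsilon>. ?T \<delta> \<epsilon>) \<longlongrightarrow> 0) (at_right 0)"
      using ker \<delta>(1) unfolding kernel_family_def by blast
    then have "((\<lambda>\<epsilon>. ?V * ennreal (?T \<delta> \<epsilon>)) \<longlongrightarrow> ?V * ennreal 0) (at_right 0)"
      using V by (intro ennreal_tendsto_cmult tendsto_ennrealI) auto
    then have "\<forall>\<^sub>F \<epsilon> in at_right 0. ?V * ennreal (?T \<delta> \<epsilon>) < ennreal (e / 2)"
      using e by (intro order_tendstoD(2)) auto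
    moreover have "\<forall>\<^sub>F \<epsilon> in at_right 0. (0::real) < \<epsilon>" by (rule eventually_at_right_less)
    ultimately show "\<forall>\<^sub>F \<epsilon> in at_right 0. dist (form_cr p \<Omega> (\<nu> \<epsilon>) v v) 0 < e"
    proof eventually_elim
      case (elim \<epsilon>)
      have "ennreal (form_cr p \<Omega> (\<nu> \<epsilon>) v v) \<le> ?S \<delta> + ?V * ennreal (?T \<delta> \<epsilon>)"
        using le[OF elim(2) \<delta>(1,2)] J[OF elim(2)] by simp
      also have "\<dots> < ennreal (e / 2) + ennreal (e / 2)"
        using \<delta>(3) elim(1) by (rule add_strict_mono)
      also have "\<dots> = ennreal e" using e by (simp add: ennreal_plus[symmetric] del: ennreal_plus)
      finally have "ennreal (form_cr p \<Omega> (\<nu> \<epsilon>) v v) < ennreal e" .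
      moreover have "0 \<le> form_cr p \<Omega> (\<nu> \<epsilon>) v v"
        unfolding form_cr_def set_lebesgue_integral_def by (intro integral_nonneg_AE AE_I2 nonneg elim(2))
      ultimately show ?case by (simp add: ennreal_less_iff)
    qed
  qed
qed

section \<open>Translation bounds for Sobolev functions\<close>

lemma integrable_powr_lborel:
  fixes f :: "'a::euclidean_space \<Rightarrow> 'b::euclidean_space"
  assumes f: "f \<in> borel_measurable lebesgue" "integrable lebesgue (\<lambda>x. norm (f x) powr p)"
    and f' [measurable]: "f' \<in> borel_measurable borel" and eq: "AE x in lborel. f x = f' x"
  shows "integrable lborel (\<lambda>x. norm (f' x) powr p)"
proof -
  have "(\<lambda>x. norm (f x) powr p) \<in> borel_measurable lebesgue" using f(2) by auto
  then have "integrable lebesgue (\<lambda>x. norm (f x) powr p) \<longleftrightarrow> integrable lborel (\<lambda>x. norm (f' x) powr p)"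
    by (rule lebesgue_lborel_cong(2)) (use eq in \<open>auto elim: eventually_mono\<close>)
  then show ?thesis using f(2) by simp
qed

lemma translation_bound_if_sobolev_W1p:
  fixes v :: "'a::euclidean_space \<Rightarrow> real"
  assumes p: "1 < p" and v: "v \<in> sobolev_W1p p UNIV"
    and v' [measurable]: "v' \<in> borel_measurable borel" and vv': "AE x in lborel. v x = v' x"
  obtains g :: "'a \<Rightarrow> 'a" where "g \<in> borel_measurable borel" "integrable lborel (\<lambda>x. norm (g x) powr p)"
    "translation_bound p v' (\<lambda>x. ennreal (2 powr p * norm (g x) powr p))"
proof -
  have vm: "v \<in> borel_measurable lebesgue" "integrable lebesgue (\<lambda>x. norm (v x) powr p)"
    using v by (auto simp: sobolev_W1p_def Lp_on_def lebesgue_on_UNIV_eq)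
  obtain g where g: "g \<in> borel_measurable lebesgue" "integrable lebesgue (\<lambda>x. norm (g x) powr p)"
    and weak: "weak_gradient_on UNIV v g"
    using v by (auto simp: sobolev_W1p_def Lp_on_def lebesgue_on_UNIV_eq)
  obtain g' where g' [measurable]: "g' \<in> borel_measurable borel" and gg': "AE x in lborel. g x = g' x"
    using borel_representative[OF g(1)] .
  have gint: "integrable lborel (\<lambda>x. norm (g' x) powr p)"
    by (rule integrable_powr_lborel[OF g g' gg'])
  have vint: "integrable lborel (\<lambda>x. \<bar>v' x\<bar> powr p)"
    using integrable_powr_lborel[OF vm v' vv'] by simp
  have "translation_bound p v' (\<lambda>x. ennreal (2 powr p * norm (g' x) powr p))"
  proof (rule weak_gradient_translation_bound[OF p v' g' vint gint])
    fix \<phi> :: "'a \<Rightarrow> real" and b :: 'a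
    assume \<phi>: "\<phi> \<in> test_functions UNIV" and b: "b \<in> Basis"
    note [measurable] = test_function_measurable[OF \<phi>]
    have \<phi>m: "\<phi> \<in> borel_measurable lebesgue" "grad \<phi> \<in> borel_measurable lebesgue"
      by (rule measurable_completion, simp)+
    have "(LINT x|lborel. v' x * (grad \<phi> x \<bullet> b)) = (LINT x|lebesgue. v x * (grad \<phi> x \<bullet> b))"
    proof (rule lebesgue_lborel_cong(1)[symmetric])
      show "(\<lambda>x. v x * (grad \<phi> x \<bullet> b)) \<in> borel_measurable lebesgue"
        using vm \<phi>m by measurable
      show "AE x in lborel. v x * (grad \<phi> x \<bullet> b) = v' x * (grad \<phi> x \<bullet> b)"
        using vv' by eventually_elim simp
    qed measurable
    also have "\<dots> = - (LINT x|lebesgue. (g x \<bullet> b) * \<phi> x)"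
      using weak \<phi> b by (simp add: weak_gradient_on_def lebesgue_on_UNIV_eq)
    also have "(LINT x|lebesgue. (g x \<bullet> b) * \<phi> x) = (LINT x|lborel. (g' x \<bullet> b) * \<phi> x)"
    proof (rule lebesgue_lborel_cong(1))
      show "(\<lambda>x. (g x \<bullet> b) * \<phi> x) \<in> borel_measurable lebesgue"
        using g(1) \<phi>m by measurable
      show "AE x in lborel. (g x \<bullet> b) * \<phi> x = (g' x \<bullet> b) * \<phi> x"
        using gg' by eventually_elim simp
    qed measurable
    finally show "(LINT x|lborel. v' x * (grad \<phi> x \<bullet> b)) = - (LINT x|lborel. (g' x \<bullet> b) * \<phi> x)" .
  qed
  then show thesis by (rule that[OF g' gint])
qed

lemma test_function_powr_integrable:
  assumes \<phi>: "\<phi> \<in> test_functions U" and p: "1 < p"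
  shows "integrable lborel (\<lambda>x. \<bar>\<phi> x\<bar> powr p)" "integrable lborel (\<lambda>x. norm (grad \<phi> x) powr p)"
proof -
  note [measurable] = test_function_measurable[OF \<phi>]
  obtain R M where RM: "0 \<le> M" "0 \<le> R" "\<And>x. \<bar>\<phi> x\<bar> \<le> M" "\<And>x. norm (grad \<phi> x) \<le> M"
    "\<And>x. R < norm x \<Longrightarrow> \<phi> x = 0" "\<And>x. R < norm x \<Longrightarrow> grad \<phi> x = 0"
    by (rule test_function_bounded[OF \<phi>]) (rule that)
  have ball: "integrable lborel (\<lambda>x :: 'a. indicator (cball 0 R) x * (M powr p) :: real)"
    using emeasure_bounded_finite[OF bounded_cball, of "0 :: 'a" R] by (intro integrable_mult_left) (simp add: integrable_indicator_iff)
  have le: "norm (a powr p) \<le> norm (indicator (cball 0 R) x * (M powr p) :: real)"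
    if "0 \<le> a" "a \<le> M" "R < norm x \<Longrightarrow> a = 0" for a and x :: 'a
    using that p powr_mono2[of p a M] by (cases "R < norm x") (auto split: split_indicator)
  show "integrable lborel (\<lambda>x. \<bar>\<phi> x\<bar> powr p)"
    by (rule Bochner_Integration.integrable_bound[OF ball], measurable, intro AE_I2 le) (use RM in auto)
  show "integrable lborel (\<lambda>x. norm (grad \<phi> x) powr p)"
    by (rule Bochner_Integration.integrable_bound[OF ball], measurable, intro AE_I2 le) (use RM in auto)
qed

text \<open>Translates convergence stated with Bochner integrals over \<open>S\<close> into convergence of nonnegative integrals
over the whole space. Integrability of the differences is essential, since the Bochner integral of a
non-integrable function is \<open>0\<close>.\<close>

lemma nn_integral_powr_diff_tendsto_0:
  fixes f :: "'a::euclidean_space \<Rightarrow> 'b::euclidean_space"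
  assumes p: "1 < p" and S: "S \<in> sets lebesgue" and f: "f \<in> borel_measurable (lebesgue_on S)"
    and f' [measurable]: "f' \<in> borel_measurable borel" and eq: "AE x in lborel. indicator S x *\<^sub>R f x = f' x"
    and int: "integrable lborel (\<lambda>x. norm (f' x) powr p)"
    and \<psi> [measurable]: "\<And>n. \<psi> n \<in> borel_measurable borel"
    and \<psi>int: "\<And>n. integrable lborel (\<lambda>x. norm (\<psi> n x) powr p)" and \<psi>0: "\<And>n x. x \<notin> S \<Longrightarrow> \<psi> n x = 0"
    and lim: "(\<lambda>n. LINT x|lebesgue_on S. norm (f x - \<psi> n x) powr p) \<longlonglongrightarrow> 0"
  shows "(\<lambda>n. \<integral>\<^sup>+x. ennreal (norm (f' x - \<psi> n x) powr p) \<partial>lborel) \<longlonglongrightarrow> 0"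
proof -
  have "(\<integral>\<^sup>+x. ennreal (norm (f' x - \<psi> n x) powr p) \<partial>lborel) = ennreal (LINT x|lebesgue_on S. norm (f x - \<psi> n x) powr p)" for n
  proof -
    have \<psi>m: "\<psi> n \<in> borel_measurable lebesgue"
      by (rule measurable_completion) simp
    \<comment> \<open>Only the zero extension of \<open>f\<close> is controlled outside \<open>S\<close>; there \<open>\<psi> n\<close> vanishes
      as well, so the restricted integral is one over the whole space.\<close>
    have Sf: "(\<lambda>x. indicator S x *\<^sub>R f x) \<in> borel_measurable lebesgue"
      by (rule measurable_zero_extension[OF f S])
    have eqn: "indicator S x *\<^sub>R (norm (f x - \<psi> n x) powr p) = norm (indicator S x *\<^sub>R f x - \<psi> n x) powr p" for x
      using \<psi>0[of x n] by (auto split: split_indicator)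
    have "(LINT x|lebesgue_on S. norm (f x - \<psi> n x) powr p) = (LINT x|lebesgue. norm (indicator S x *\<^sub>R f x - \<psi> n x) powr p)"
      using S by (subst integral_restrict_space) (simp_all only: eqn, simp)
    also have "\<dots> = (LINT x|lborel. norm (f' x - \<psi> n x) powr p)"
    proof (rule lebesgue_lborel_cong(1))
      show "(\<lambda>x. norm (indicator S x *\<^sub>R f x - \<psi> n x) powr p) \<in> borel_measurable lebesgue"
        using borel_measurable_diff[OF Sf \<psi>m] by measurable
      show "AE x in lborel. norm (indicator S x *\<^sub>R f x - \<psi> n x) powr p = norm (f' x - \<psi> n x) powr p"
        using eq by eventually_elim simp
    qed measurable
    finally have "ennreal (LINT x|lebesgue_on S. norm (f x - \<psi> n x) powr p) = ennreal (LINT x|lborel. norm (f' x - \<psi> n x) powr p)"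
      by simp
    also have "\<dots> = (\<integral>\<^sup>+x. ennreal (norm (f' x - \<psi> n x) powr p) \<partial>lborel)"
    proof (rule nn_integral_eq_integral[symmetric])
      show "integrable lborel (\<lambda>x. norm (f' x - \<psi> n x) powr p)"
      proof (rule Bochner_Integration.integrable_bound)
        show "integrable lborel (\<lambda>x. 2 powr p * (norm (f' x) powr p + norm (\<psi> n x) powr p))"
          by (intro integrable_mult_right Bochner_Integration.integrable_add int \<psi>int)
        show "AE x in lborel. norm (norm (f' x - \<psi> n x) powr p) \<le> norm (2 powr p * (norm (f' x) powr p + norm (\<psi> n x) powr p))"
          using powr_add_le[OF p norm_ge_zero norm_ge_zero norm_ge_zero norm_triangle_ineq4] by (intro AE_I2) simp
      qed measurable
    qed simp
    finally show ?thesis by simp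
  qed
  then show ?thesis
    using tendsto_ennrealI[OF lim] by simp
qed

text \<open>The test functions and their gradients vanish outside \<open>\<Omega>\<close>, as does \<open>v\<close> almost everywhere.
Hence they converge to \<open>v\<close> and to the zero extension of the weak gradient on the whole space.\<close>

lemma translation_bound_if_sobolev_W01p:
  fixes v :: "'a::euclidean_space \<Rightarrow> real"
  assumes p: "1 < p" and \<Omega>: "open \<Omega>" and v: "v \<in> sobolev_W01p p \<Omega>" and v0: "AE x in lebesgue. x \<notin> \<Omega> \<longrightarrow> v x = 0"
    and v' [measurable]: "v' \<in> borel_measurable borel" and vv': "AE x in lborel. v x = v' x"
    and vint: "integrable lborel (\<lambda>x. norm (v' x) powr p)"
  obtains g :: "'a \<Rightarrow> 'a" where "g \<in> borel_measurable borel" "integrable lborel (\<lambda>x. norm (g x) powr p)"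
    "\<And>x. x \<notin> \<Omega> \<Longrightarrow> g x = 0" "translation_bound p v' (\<lambda>x. ennreal (8 powr p * norm (g x) powr p))"
proof -
  have S: "\<Omega> \<in> sets lebesgue" and [measurable]: "\<Omega> \<in> sets borel"
    using \<Omega> by auto
  obtain g \<phi> where vm: "v \<in> borel_measurable (lebesgue_on \<Omega>)"
    and g: "g \<in> borel_measurable (lebesgue_on \<Omega>)" "integrable (lebesgue_on \<Omega>) (\<lambda>x. norm (g x) powr p)"
    and \<phi>: "\<And>n. \<phi> n \<in> test_functions \<Omega>"
    and lim: "(\<lambda>n. LINT x|lebesgue_on \<Omega>. \<bar>v x - \<phi> n x\<bar> powr p) \<longlonglongrightarrow> 0"
      "(\<lambda>n. LINT x|lebesgue_on \<Omega>. norm (g x - grad (\<phi> n) x) powr p) \<longlonglongrightarrow> 0"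
    using v unfolding sobolev_W01p_def Lp_on_def by blast
  have \<phi>0: "\<phi> n x = 0" "grad (\<phi> n) x = 0" if "x \<notin> \<Omega>" for n x
  proof -
    have "x \<notin> closure {x. \<phi> n x \<noteq> 0}" using \<phi>[of n] that by (auto simp: test_functions_def)
    then show "\<phi> n x = 0" "grad (\<phi> n) x = 0"
      using closure_subset[of "{x. \<phi> n x \<noteq> 0}"] by (auto intro: grad_eq_0_outside)
  qed
  let ?g = "\<lambda>x. indicator \<Omega> x *\<^sub>R g x"
  have gm: "?g \<in> borel_measurable lebesgue"
    by (rule measurable_zero_extension[OF g(1) S])
  obtain g1 where g1 [measurable]: "g1 \<in> borel_measurable borel" and gg1: "AE x in lborel. ?g x = g1 x"
    using borel_representative[OF gm] .
  \<comment> \<open>The second factor makes the representative vanish at every point outside \<open>\<Omega>\<close>, and not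
    just almost everywhere: the frontier might have positive measure.\<close>
  define g' where "g' x = indicator \<Omega> x *\<^sub>R g1 x" for x
  have g' [measurable]: "g' \<in> borel_measurable borel" unfolding g'_def by measurable
  have gg': "AE x in lborel. ?g x = g' x"
    using gg1 by eventually_elim (auto simp: g'_def split: split_indicator)
  have "integrable lebesgue (\<lambda>x. indicator \<Omega> x *\<^sub>R (norm (g x) powr p))"
    using g(2) S by (subst (asm) integrable_restrict_space) auto
  moreover have "indicator \<Omega> x *\<^sub>R (norm (g x) powr p) = norm (?g x) powr p" for x
    by (auto split: split_indicator)
  ultimately have "integrable lebesgue (\<lambda>x. norm (?g x) powr p)" by simp
  then have gint: "integrable lborel (\<lambda>x. norm (g' x) powr p)"
    by (rule integrable_powr_lborel[OF gm _ g' gg'])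
  have "AE x in lborel. x \<notin> \<Omega> \<longrightarrow> v x = 0" using v0 by (simp add: AE_completion_iff)
  with vv' have vv0: "AE x in lborel. indicator \<Omega> x *\<^sub>R v x = v' x"
    by eventually_elim (auto split: split_indicator)
  have "translation_bound p v' (\<lambda>x. ennreal (8 powr p * norm (g' x) powr p))"
  proof (rule translation_bound_limit[OF p v' g' \<phi>])
    show "(\<lambda>n. \<integral>\<^sup>+x. ennreal (\<bar>v' x - \<phi> n x\<bar> powr p) \<partial>lborel) \<longlonglongrightarrow> 0"
      using nn_integral_powr_diff_tendsto_0[OF p S vm v' vv0 vint, of \<phi>] test_function_measurable(1)[OF \<phi>]
        test_function_powr_integrable(1)[OF \<phi> p] \<phi>0(1) lim(1) by simp
    show "(\<lambda>n. \<integral>\<^sup>+x. ennreal (norm (g' x - grad (\<phi> n) x) powr p) \<partial>lborel) \<longlonglongrightarrow> 0"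
      using nn_integral_powr_diff_tendsto_0[OF p S g(1) g' gg' gint, of "\<lambda>n. grad (\<phi> n)"] test_function_measurable(2)[OF \<phi>]
        test_function_powr_integrable(2)[OF \<phi> p] \<phi>0(2) lim(2) by simp
  qed
  moreover have "g' x = 0" if "x \<notin> \<Omega>" for x using that by (simp add: g'_def)
  ultimately show thesis by (intro that[OF g' gint])
qed

text \<open>If \<open>b \<le> e * a\<close>, the first term on the right suffices; otherwise \<open>a\<close> is less than \<open>b / e\<close>
and the second one does.\<close>

section \<open>Mixed forms\<close>

lemma young_powr:
  fixes a b :: real
  assumes "1 < p" "0 < e" "0 \<le> a" "0 \<le> b"
  shows "a powr (p - 1) * b \<le> e * a powr p + e powr (1 - p) * b powr p"
proof (cases "b \<le> e * a")
  case True
  have "a powr (p - 1) * b \<le> a powr (p - 1) * (e * a)"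
    using True by (intro mult_left_mono) auto
  also have "\<dots> = e * a powr p"
    using assms by (cases "a = 0") (auto simp: powr_diff)
  finally show ?thesis by (simp add: add_increasing2)
next
  case False
  moreover have "0 \<le> e * a" using assms by simp
  ultimately have b: "0 < b" by linarith
  have "a \<le> b / e" using False assms by (simp add: field_simps)
  then have "a powr (p - 1) * b \<le> (b / e) powr (p - 1) * b"
    using assms by (intro mult_right_mono powr_mono2) auto
  also have "\<dots> = e powr (1 - p) * b powr p"
    using assms b by (simp add: powr_divide powr_diff field_simps)
  finally show ?thesis using assms by (simp add: add_increasing)
qed

lemma form_integrand_le:
  fixes u v :: "'a::euclidean_space \<Rightarrow> real"
  assumes p: "1 < p" and e: "0 < e" and \<nu>: "0 \<le> \<nu> (x - y)"
  shows "\<bar>form_integrand p \<nu> u v (x, y)\<bar>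
    \<le> e * form_integrand p \<nu> u u (x, y) + e powr (1 - p) * form_integrand p \<nu> v v (x, y)"
proof -
  let ?a = "\<bar>u x - u y\<bar>" and ?b = "\<bar>v x - v y\<bar>"
  have "?a powr (p - 2) * ?a = ?a powr (p - 1)"
    using powr_add[of ?a "p - 2" 1] by (cases "u x = u y") auto
  then have "\<bar>form_integrand p \<nu> u v (x, y)\<bar> = ?a powr (p - 1) * ?b * \<nu> (x - y)"
    using \<nu> by (simp add: form_integrand_def abs_mult)
  also have "\<dots> \<le> (e * ?a powr p + e powr (1 - p) * ?b powr p) * \<nu> (x - y)"
    using young_powr[OF p e, of ?a ?b] \<nu> by (intro mult_right_mono) auto
  finally show ?thesis by (simp add: form_integrand_diag algebra_simps)
qed

text \<open>The usual absorption argument: \<open>e\<close> is fixed before the limit is taken, and \<open>c\<close> may depend on it.\<close>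

lemma tendsto_0_if_absorbed:
  fixes X J :: "real \<Rightarrow> real"
  assumes J: "(J \<longlongrightarrow> 0) F" and le: "\<And>e. 0 < e \<Longrightarrow> \<exists>c. \<forall>\<^sub>F t in F. \<bar>X t\<bar> \<le> e * M + c * J t"
  shows "(X \<longlongrightarrow> 0) F"
proof (rule tendstoI)
  fix r :: real assume r: "0 < r"
  define m where "m = \<bar>M\<bar> + 1"
  have m: "0 < m" "M \<le> m" by (auto simp: m_def)
  define e where "e = r / 2 / m"
  have e: "0 < e" using r m by (simp add: e_def)
  have "e * M \<le> e * m" using e m by (intro mult_left_mono) auto
  also have "\<dots> = r / 2" using m by (simp add: e_def)
  finally have eM: "e * M \<le> r / 2" .
  obtain c where c: "\<forall>\<^sub>F t in F. \<bar>X t\<bar> \<le> e * M + c * J t" using le[OF e] by blast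
  have "((\<lambda>t. c * J t) \<longlongrightarrow> c * 0) F" by (intro tendsto_intros J)
  then have "\<forall>\<^sub>F t in F. c * J t < r / 2" using r by (intro order_tendstoD) auto
  with c show "\<forall>\<^sub>F t in F. dist (X t) 0 < r"
    by eventually_elim (use eM in auto)
qed

theorem theorem2p10:
  fixes p :: real
    and \<Omega> :: "'a::euclidean_space set"
    and \<nu> :: "real \<Rightarrow> 'a \<Rightarrow> real"
    and u :: "real \<Rightarrow> 'a \<Rightarrow> real"
    and v :: "'a \<Rightarrow> real"
  assumes "1 < p"
    and "kernel_family p \<nu>"
    and "open \<Omega>"
    and "v \<in> sobolev_W1p p UNIV"
    and "(v \<in> sobolev_W01p p \<Omega> \<and> (AE x in lebesgue. x \<notin> \<Omega> \<longrightarrow> v x = 0))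
         \<or> frontier \<Omega> \<in> null_sets lebesgue"
    and "\<And>\<epsilon>. 0 < \<epsilon> \<Longrightarrow> u \<epsilon> \<in> nonlocal_W p \<Omega> (\<nu> \<epsilon>)"
    and "bdd_above ((\<lambda>\<epsilon>. form_cr p \<Omega> (\<nu> \<epsilon>) (u \<epsilon>) (u \<epsilon>)) ` {0<..})"
  shows "(\<forall>\<epsilon>>0. set_integrable lebesgue (\<Omega> \<times> (- \<Omega>)) (form_integrand p (\<nu> \<epsilon>) (u \<epsilon>) v) \<and>
                set_integrable lebesgue (\<Omega> \<times> (- \<Omega>)) (form_integrand p (\<nu> \<epsilon>) v (u \<epsilon>)))
       \<and> ((\<lambda>\<epsilon>. form_cr p \<Omega> (\<nu> \<epsilon>) (u \<epsilon>) v) \<longlongrightarrow> 0) (at_right 0)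
       \<and> ((\<lambda>\<epsilon>. form_cr p \<Omega> (\<nu> \<epsilon>) v (u \<epsilon>)) \<longlongrightarrow> 0) (at_right 0)"
proof -
  note p = assms(1) and ker = assms(2) and \<Omega> = assms(3)
  have vm: "v \<in> borel_measurable lebesgue" "integrable lebesgue (\<lambda>x. norm (v x) powr p)"
    using assms(4) by (auto simp: sobolev_W1p_def Lp_on_def lebesgue_on_UNIV_eq)
  obtain v' where v' [measurable]: "v' \<in> borel_measurable borel" and vv': "AE x in lborel. v x = v' x"
    using borel_representative[OF vm(1)] .
  have vint: "integrable lborel (\<lambda>x. norm (v' x) powr p)"
    by (rule integrable_powr_lborel[OF vm v' vv'])
  have fr: "frontier \<Omega> \<in> sets borel" by (intro borel_closed frontier_closed)
  have "\<exists>c. \<exists>g :: 'a \<Rightarrow> 'a. g \<in> borel_measurable borel \<and> integrable lborel (\<lambda>x. norm (g x) powr p) \<and> 0 \<le> c \<and>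
      translation_bound p v' (\<lambda>x. ennreal (c * norm (g x) powr p)) \<and>
      (AE x in lborel. x \<in> frontier \<Omega> \<longrightarrow> g x = 0)"
    using assms(5)
  proof (elim disjE conjE)
    assume W: "v \<in> sobolev_W01p p \<Omega>" and v0: "AE x in lebesgue. x \<notin> \<Omega> \<longrightarrow> v x = 0"
    obtain g :: "'a \<Rightarrow> 'a" where g: "g \<in> borel_measurable borel" "integrable lborel (\<lambda>x. norm (g x) powr p)"
      "\<And>x. x \<notin> \<Omega> \<Longrightarrow> g x = 0" "translation_bound p v' (\<lambda>x. ennreal (8 powr p * norm (g x) powr p))"
      by (rule translation_bound_if_sobolev_W01p[OF p \<Omega> W v0 v' vv' vint]) (rule that)
    have "AE x in lborel. x \<in> frontier \<Omega> \<longrightarrow> g x = 0"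
      using g(3) \<Omega> by (auto simp: frontier_def interior_open)
    with g(1,2,4) powr_ge_zero[of 8 p] show ?thesis by (intro exI conjI)
  next
    assume "frontier \<Omega> \<in> null_sets lebesgue"
    then have "frontier \<Omega> \<in> null_sets lborel" using fr by (simp add: null_sets_completion_iff)
    then have null: "AE x in lborel. x \<notin> frontier \<Omega>" by (rule AE_not_in)
    obtain g :: "'a \<Rightarrow> 'a" where g: "g \<in> borel_measurable borel" "integrable lborel (\<lambda>x. norm (g x) powr p)"
      "translation_bound p v' (\<lambda>x. ennreal (2 powr p * norm (g x) powr p))"
      by (rule translation_bound_if_sobolev_W1p[OF p assms(4) v' vv']) (rule that)
    have "AE x in lborel. x \<in> frontier \<Omega> \<longrightarrow> g x = 0"
      using null by eventually_elim simp
    with g powr_ge_zero[of 2 p] show ?thesis by (intro exI conjI)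
  qed
  then obtain c and g :: "'a \<Rightarrow> 'a" where g [measurable]: "g \<in> borel_measurable borel"
    and gint: "integrable lborel (\<lambda>x. norm (g x) powr p)" and c: "0 \<le> c"
    and bound: "translation_bound p v' (\<lambda>x. ennreal (c * norm (g x) powr p))"
    and g0: "AE x in lborel. x \<in> frontier \<Omega> \<longrightarrow> g x = 0"
    by (elim exE conjE) (rule that)
  have "integrable lborel (\<lambda>x. c * norm (g x) powr p)" using gint by simp
  then have Gfin: "(\<integral>\<^sup>+x. ennreal (c * norm (g x) powr p) \<partial>lborel) < \<infinity>"
    using c by (subst nn_integral_eq_integral) auto
  have "AE x in lborel. ennreal (c * norm (g x) powr p) * indicator (frontier \<Omega>) x = 0"
    using g0 by eventually_elim (auto split: split_indicator)
  then have Gfr: "(\<integral>\<^sup>+x. ennreal (c * norm (g x) powr p) * indicator (frontier \<Omega>) x \<partial>lborel) = 0"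
    using fr by (subst nn_integral_0_iff_AE) auto
  have vfin: "(\<integral>\<^sup>+x. ennreal (\<bar>v' x\<bar> powr p) \<partial>lborel) < \<infinity>"
    using nn_integral_eq_integral[OF vint] by simp
  note self = self_crossing_energy_tendsto_0[OF p ker \<Omega> vm(1) v' vv' vfin _ Gfin Gfr bound]
  let ?C = "\<Omega> \<times> - \<Omega>"
  have vv: "set_integrable lebesgue ?C (form_integrand p (\<nu> \<epsilon>) v v)" if "0 < \<epsilon>" for \<epsilon>
    by (rule self(1)[OF _ that]) measurable
  have lim: "((\<lambda>\<epsilon>. form_cr p \<Omega> (\<nu> \<epsilon>) v v) \<longlongrightarrow> 0) (at_right 0)"
    by (rule self(2)) measurable
  have C: "?C \<in> sets lebesgue"
    using \<Omega> by (intro sets_completionI_sets) (simp add: borel_prod[symmetric])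
  have um: "u \<epsilon> \<in> borel_measurable lebesgue" if "0 < \<epsilon>" for \<epsilon>
    using assms(6)[OF that] by (simp add: nonlocal_W_def)
  have uu: "set_integrable lebesgue ?C (form_integrand p (\<nu> \<epsilon>) (u \<epsilon>) (u \<epsilon>))" if "0 < \<epsilon>" for \<epsilon>
    using assms(6)[OF that] C unfolding nonlocal_W_def by (auto elim: set_integrable_subset)
  obtain M where M: "\<And>\<epsilon>. 0 < \<epsilon> \<Longrightarrow> form_cr p \<Omega> (\<nu> \<epsilon>) (u \<epsilon>) (u \<epsilon>) \<le> M"
    using assms(7) by (auto simp: bdd_above_def)
  have cross: "set_integrable lebesgue ?C (form_integrand p (\<nu> \<epsilon>) f w)"
      "0 < e \<Longrightarrow> \<bar>form_cr p \<Omega> (\<nu> \<epsilon>) f w\<bar> \<le> e * form_cr p \<Omega> (\<nu> \<epsilon>) f f + e powr (1 - p) * form_cr p \<Omega> (\<nu> \<epsilon>) w w"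
    if \<epsilon>: "0 < \<epsilon>" and fm: "f \<in> borel_measurable lebesgue" and wm: "w \<in> borel_measurable lebesgue"
      and ff: "set_integrable lebesgue ?C (form_integrand p (\<nu> \<epsilon>) f f)"
      and ww: "set_integrable lebesgue ?C (form_integrand p (\<nu> \<epsilon>) w w)" for \<epsilon> e f w
  proof -
    let ?F = "\<lambda>f w z. indicator ?C z *\<^sub>R form_integrand p (\<nu> \<epsilon>) f w z"
    have \<nu>m: "\<nu> \<epsilon> \<in> borel_measurable (lebesgue_on (- {0}))" and \<nu>0: "\<And>h. h \<noteq> 0 \<Longrightarrow> 0 \<le> \<nu> \<epsilon> h"
      using ker \<epsilon> unfolding kernel_family_def by blast+
    have le: "\<bar>?F f w z\<bar> \<le> e * ?F f f z + e powr (1 - p) * ?F w w z" if e: "0 < e" for e z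
    proof (cases "z \<in> ?C")
      case True
      then obtain x y where z: "z = (x, y)" "x \<in> \<Omega>" "y \<notin> \<Omega>" by auto
      then have "x - y \<noteq> 0" by auto
      then show ?thesis
        using form_integrand_le[OF p e, of "\<nu> \<epsilon>" x y f w] \<nu>0 z by simp
    qed simp
    have dom: "integrable lebesgue (\<lambda>z. e * ?F f f z + e powr (1 - p) * ?F w w z)" for e
      using ff ww unfolding set_integrable_def by (intro Bochner_Integration.integrable_add integrable_mult_right)
    have int: "integrable lebesgue (?F f w)"
    proof (rule Bochner_Integration.integrable_bound[OF dom[of 1]])
      show "?F f w \<in> borel_measurable lebesgue"
        using C by (intro borel_measurable_scaleR borel_measurable_indicator form_integrand_measurable fm wm \<nu>m)
      show "AE z in lebesgue. norm (?F f w z) \<le> norm (1 * ?F f f z + 1 powr (1 - p) * ?F w w z)"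
        unfolding real_norm_def by (intro AE_I2 order_trans[OF le[OF zero_less_one] abs_ge_self])
    qed
    then show "set_integrable lebesgue ?C (form_integrand p (\<nu> \<epsilon>) f w)"
      by (simp add: set_integrable_def)
    assume e: "0 < e"
    have "\<bar>LINT z|lebesgue. ?F f w z\<bar> \<le> (LINT z|lebesgue. \<bar>?F f w z\<bar>)"
      by (rule integral_abs_bound)
    also have "\<dots> \<le> (LINT z|lebesgue. e * ?F f f z + e powr (1 - p) * ?F w w z)"
      using le[OF e] int dom by (intro integral_mono integrable_abs)
    also have "\<dots> = e * (LINT z|lebesgue. ?F f f z) + e powr (1 - p) * (LINT z|lebesgue. ?F w w z)"
    proof -
      have "integrable lebesgue (\<lambda>z. e * ?F f f z)" "integrable lebesgue (\<lambda>z. e powr (1 - p) * ?F w w z)"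
        by (intro integrable_mult_right ff[unfolded set_integrable_def] ww[unfolded set_integrable_def])+
      then show ?thesis
        by (simp only: Bochner_Integration.integral_add integral_mult_right_zero)
    qed
    finally show "\<bar>form_cr p \<Omega> (\<nu> \<epsilon>) f w\<bar> \<le> e * form_cr p \<Omega> (\<nu> \<epsilon>) f f + e powr (1 - p) * form_cr p \<Omega> (\<nu> \<epsilon>) w w"
      unfolding form_cr_def set_lebesgue_integral_def .
  qed
  have pos: "\<forall>\<^sub>F \<epsilon> in at_right 0. (0::real) < \<epsilon>" by (rule eventually_at_right_less)
  have "((\<lambda>\<epsilon>. form_cr p \<Omega> (\<nu> \<epsilon>) (u \<epsilon>) v) \<longlongrightarrow> 0) (at_right 0)"
  proof (rule tendsto_0_if_absorbed[OF lim])
    fix e :: real assume e: "0 < e"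
    have le: "\<bar>form_cr p \<Omega> (\<nu> \<epsilon>) (u \<epsilon>) v\<bar> \<le> e * M + e powr (1 - p) * form_cr p \<Omega> (\<nu> \<epsilon>) v v" if \<epsilon>: "0 < \<epsilon>" for \<epsilon>
      using cross(2)[OF \<epsilon> um[OF \<epsilon>] vm(1) uu[OF \<epsilon>] vv[OF \<epsilon>] e] mult_left_mono[OF M[OF \<epsilon>], of e] e by linarith
    show "\<exists>c. \<forall>\<^sub>F \<epsilon> in at_right 0. \<bar>form_cr p \<Omega> (\<nu> \<epsilon>) (u \<epsilon>) v\<bar> \<le> e * M + c * form_cr p \<Omega> (\<nu> \<epsilon>) v v"
      by (rule exI, rule eventually_mono[OF pos], rule le)
  qed
  moreover have "((\<lambda>\<epsilon>. form_cr p \<Omega> (\<nu> \<epsilon>) v (u \<epsilon>)) \<longlongrightarrow> 0) (at_right 0)"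
  proof (rule tendsto_0_if_absorbed[OF lim])
    fix e :: real assume e: "0 < e"
    \<comment> \<open>Here the bounded energy of \<open>u \<epsilon>\<close> carries the second coefficient
      \<open>d powr (1 - p)\<close> of Young's inequality, so that \<open>d\<close> is chosen to make this coefficient equal to \<open>e\<close>.\<close>
    define d where "d = e powr (1 / (1 - p))"
    have d: "0 < d" "d powr (1 - p) = e" using e p by (auto simp: d_def powr_powr)
    have le: "\<bar>form_cr p \<Omega> (\<nu> \<epsilon>) v (u \<epsilon>)\<bar> \<le> e * M + d * form_cr p \<Omega> (\<nu> \<epsilon>) v v" if \<epsilon>: "0 < \<epsilon>" for \<epsilon>
      using cross(2)[OF \<epsilon> vm(1) um[OF \<epsilon>] vv[OF \<epsilon>] uu[OF \<epsilon>] d(1)] mult_left_mono[OF M[OF \<epsilon>], of e] e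
      unfolding d(2) by linarith
    show "\<exists>c. \<forall>\<^sub>F \<epsilon> in at_right 0. \<bar>form_cr p \<Omega> (\<nu> \<epsilon>) v (u \<epsilon>)\<bar> \<le> e * M + c * form_cr p \<Omega> (\<nu> \<epsilon>) v v"
      by (rule exI, rule eventually_mono[OF pos], rule le)
  qed
  moreover have "set_integrable lebesgue ?C (form_integrand p (\<nu> \<epsilon>) (u \<epsilon>) v) \<and>
      set_integrable lebesgue ?C (form_integrand p (\<nu> \<epsilon>) v (u \<epsilon>))" if \<epsilon>: "0 < \<epsilon>" for \<epsilon>
    using cross(1)[OF \<epsilon> um[OF \<epsilon>] vm(1) uu[OF \<epsilon>] vv[OF \<epsilon>]] cross(1)[OF \<epsilon> vm(1) um[OF \<epsilon>] vv[OF \<epsilon>] uu[OF \<epsilon>]] ..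
  ultimately show ?thesis by simp
qed

end
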